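(* Let $\nu\in(0,1)$ and $\lambda>0$. Let $\{X_n:n\geq 1\}$ be i.i.d. real random variables such that $\mathbb{E}[e^{\theta X_1}]<\infty$ for all $\theta$ in a neighborhood of $0$, with $\mu:=\mathbb{E}[X_1]$ and $\sigma^2:=\mathrm{Var}[X_1]$, and let $\{N_{\nu,\lambda}(t):t\geq 0\}$ be a time fractional Poisson process with parameters $\nu,\lambda$, independent of $\{X_n:n\geq 1\}$. Set $S_{\nu,\lambda}(t):=\sum_{k=1}^{N_{\nu,\lambda}(t)}X_k$ for $t\geq 0$, and let $\alpha(\nu):=1-\nu/2$ if $\mu=0$ and $\alpha(\nu):=1-\nu$ if $\mu\neq 0$. Let $L_\nu(1)$ be the value at time $1$ of the inverse of the $\nu$-stable subordinator. Then, as $t\to\infty$: \begin{itemize} \item if $\mu=0$, then $\left\{t^{\alpha(\nu)}\frac{S_{\nu,\lambda}(t)}{t}:t>0\right\}$ converges weakly to $\sqrt{\lambda\sigma^2L_\nu(1)}\,Z$, where $Z$ is a standard Normal random variable independent of $L_\nu(1)$; \item if $\mu\neq 0$, then $\left\{t^{\alpha(\nu)}\frac{S_{\nu,\lambda}(t)}{t}:t>0\right\}$ converges weakly to $\lambda\mu L_\nu(1)$. \end{itemize}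
   Context: Time fractional Poisson process: for $\nu\in(0,1)$ and $\lambda>0$, $N_{\nu,\lambda}(t)=N_{1,\lambda}(L_\nu(t))$ for all $t\geq 0$, where $\{N_{1,\lambda}(t):t\geq 0\}$ is a standard (homogeneous) Poisson process with rate $\lambda$ and $\{L_\nu(t):t\geq 0\}$ is an independent inverse of the stable subordinator, i.e. $L_\nu(t)=\inf\{s\geq 0: D_\nu(s)>t\}$, where $\{D_\nu(s):s\geq 0\}$ is the $\nu$-stable subordinator with $\mathbb{E}[e^{-\xi D_\nu(s)}]=e^{-s\xi^\nu}$ for $\xi\geq 0$. With this normalization $\mathbb{E}[e^{\theta L_\nu(t)}]=E_\nu(\theta t^\nu)$ for all $\theta\in\mathbb{R}$, where $E_\nu(x):=\sum_{k=0}^\infty\frac{x^k}{\Gamma(\nu k+1)}$ is the Mittag-Leffler function. An empty sum is $0$. Weak convergence means convergence in distribution. *)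

theory Defs
  imports "HOL-Probability.Probability"
begin

text \<open>
  Processes are indexed by \<^typ>\<open>real\<close>, but only their values at nonnegative times are
  constrained. Path properties and pathwise identities are required almost surely.
\<close>

text \<open>
  Independence of the sigma-algebras generated by two whole families of random variables.
  \<^const>\<open>prob_space.indep_var\<close> on product spaces would force a common value type.
\<close>

definition (in prob_space) indep_families ::
    "'i set \<Rightarrow> 'c measure \<Rightarrow> ('i \<Rightarrow> 'a \<Rightarrow> 'c) \<Rightarrow> 'j set \<Rightarrow> 'd measure \<Rightarrow> ('j \<Rightarrow> 'a \<Rightarrow> 'd) \<Rightarrow> bool" where
  "indep_families I E X J F Y \<longleftrightarrow>
     (\<forall>i\<in>I. random_variable E (X i)) \<and> (\<forall>j\<in>J. random_variable F (Y j)) \<and>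
     indep_set (sigma_sets (space M) {X i -` A \<inter> space M | i A. i \<in> I \<and> A \<in> sets E})
               (sigma_sets (space M) {Y j -` B \<inter> space M | j B. j \<in> J \<and> B \<in> sets F})"

definition (in prob_space) indep_increments :: "(real \<Rightarrow> 'a \<Rightarrow> real) \<Rightarrow> bool" where
  "indep_increments X \<longleftrightarrow>
     (\<forall>(\<tau>::nat \<Rightarrow> real) n. 0 \<le> \<tau> 0 \<and> mono_on {..n} \<tau> \<longrightarrow>
        indep_vars (\<lambda>_. borel) (\<lambda>i \<omega>. X (\<tau> (Suc i)) \<omega> - X (\<tau> i) \<omega>) {..<n})"

text \<open>Left limits of the paths exist automatically by monotonicity.\<close>

definition (in prob_space) nondecreasing_cadlag :: "(real \<Rightarrow> 'a \<Rightarrow> real) \<Rightarrow> bool" where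
  "nondecreasing_cadlag X \<longleftrightarrow>
     (AE \<omega> in M. mono_on {0..} (\<lambda>t. X t \<omega>) \<and>
                 (\<forall>t\<ge>0. continuous (at_right t) (\<lambda>s. X s \<omega>)))"

definition (in prob_space) poisson_process :: "real \<Rightarrow> (real \<Rightarrow> 'a \<Rightarrow> nat) \<Rightarrow> bool" where
  "poisson_process r N \<longleftrightarrow>
     (\<forall>t\<ge>0. random_variable (count_space UNIV) (N t)) \<and>
     (AE \<omega> in M. N 0 \<omega> = 0) \<and>
     indep_increments (\<lambda>t \<omega>. real (N t \<omega>)) \<and>
     (\<forall>s\<ge>0. \<forall>t>s. \<forall>k. prob {\<omega> \<in> space M. N t \<omega> = N s \<omega> + k} = pmf (poisson_pmf (r * (t - s))) k) \<and>
     nondecreasing_cadlag (\<lambda>t \<omega>. real (N t \<omega>))"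

definition (in prob_space) stable_subordinator :: "real \<Rightarrow> (real \<Rightarrow> 'a \<Rightarrow> real) \<Rightarrow> bool" where
  "stable_subordinator \<nu> D \<longleftrightarrow>
     (\<forall>s\<ge>0. random_variable borel (D s)) \<and>
     (AE \<omega> in M. D 0 \<omega> = 0) \<and>
     indep_increments D \<and>
     (\<forall>s\<ge>0. \<forall>t\<ge>s. distr M borel (\<lambda>\<omega>. D t \<omega> - D s \<omega>) = distr M borel (D (t - s))) \<and>
     nondecreasing_cadlag D \<and>
     (\<forall>s\<ge>0. \<forall>\<xi>\<ge>0. expectation (\<lambda>\<omega>. exp (- \<xi> * D s \<omega>)) = exp (- s * \<xi> powr \<nu>))"

text \<open>
  The infimum is over a nonempty set almost surely, since the paths of \<open>D\<close> are almost surely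
  unbounded; the exceptional null set is the reason for demanding measurability separately.
\<close>

definition (in prob_space) inverse_stable_subordinator :: "real \<Rightarrow> (real \<Rightarrow> 'a \<Rightarrow> real) \<Rightarrow> bool" where
  "inverse_stable_subordinator \<nu> L \<longleftrightarrow>
     (\<forall>t\<ge>0. random_variable borel (L t)) \<and>
     (\<exists>D. stable_subordinator \<nu> D \<and>
          (AE \<omega> in M. \<forall>t\<ge>0. L t \<omega> = Inf {s. 0 \<le> s \<and> D s \<omega> > t}))"

definition (in prob_space) time_fractional_poisson_process ::
    "real \<Rightarrow> real \<Rightarrow> (real \<Rightarrow> 'a \<Rightarrow> nat) \<Rightarrow> bool" where
  "time_fractional_poisson_process \<nu> r N \<longleftrightarrow>
     (\<forall>t\<ge>0. random_variable (count_space UNIV) (N t)) \<and>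
     (\<exists>N1 L. poisson_process r N1 \<and> inverse_stable_subordinator \<nu> L \<and>
             indep_families {0..} (count_space UNIV) N1 {0..} borel L \<and>
             (AE \<omega> in M. \<forall>t\<ge>0. N t \<omega> = N1 (L t \<omega>) \<omega>))"

definition scaling_exponent :: "real \<Rightarrow> real \<Rightarrow> real" where
  "scaling_exponent \<nu> \<mu> = (if \<mu> = 0 then 1 - \<nu> / 2 else 1 - \<nu>)"

text \<open>
  \<^const>\<open>weak_conv_m\<close> with the sequential limit replaced by a limit along an arbitrary filter,
  stated for random variables, which may live on different probability spaces.
\<close>

definition converges_in_distribution ::
    "'a measure \<Rightarrow> ('i \<Rightarrow> 'a \<Rightarrow> real) \<Rightarrow> 'b measure \<Rightarrow> ('b \<Rightarrow> real) \<Rightarrow> 'i filter \<Rightarrow> bool" where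
  "converges_in_distribution M Y M' Y' F \<longleftrightarrow>
     (\<forall>x. isCont (cdf (distr M' borel Y')) x \<longrightarrow>
        ((\<lambda>i. cdf (distr M borel (Y i)) x) \<longlongrightarrow> cdf (distr M' borel Y') x) F)"

end

theory Submission
  imports Defs
begin

text \<open>
  Conditioning on \<open>N\<close> and then on the random time gives the characteristic function of the normalised
  sum \<open>c S(t)\<close> at \<open>u\<close> as \<open>E[\<phi>(c u) ^ N(t)] = E[exp(\<lambda> L(t) (\<phi>(c u) - 1))]\<close>, where \<open>\<phi>\<close> is the characteristic
  function of \<open>X 1\<close>. By self-similarity \<open>L(t)\<close> has the law of \<open>t powr \<nu> * L(1)\<close>, so the exponent becomes
  \<open>\<lambda> L(1)\<close> times \<open>t powr \<nu> * (\<phi>(c u) - 1)\<close>. With \<open>c\<close> equal to \<open>t powr (- \<nu> / 2)\<close> in the centred case and to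
  \<open>t powr - \<nu>\<close> otherwise, that factor tends to \<open>- \<sigma>\<^sup>2 u\<^sup>2 / 2\<close>, respectively to \<open>\<i> u \<mu>\<close>. Dominated
  convergence and Levy's continuity theorem conclude. Self-similarity holds because the law of
  \<open>D(s)\<close> is determined by its Laplace transform, that is, by the moments of \<open>exp (- D(s))\<close>, a variable
  with values in the unit interval, and because \<open>{L(t) < s}\<close>, \<open>{D(s) > t}\<close>, \<open>{L(t) \<le> s}\<close> increase.
\<close>

section \<open>Stable subordinators\<close>

text \<open>For a variable bounded by 1, the Taylor polynomial of order \<open>n\<close> of the
  characteristic function at \<open>t\<close> has error at most
  \<open>2 * \<bar>t\<bar> ^ n / fact n\<close>, which tends to 0. The moments therefore determine
  the characteristic function.\<close>

lemma moments_determine_distr_bounded: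
  fixes Y :: "'a \<Rightarrow> real" and Y' :: "'b \<Rightarrow> real"
  assumes "prob_space M" "prob_space M'"
    and [measurable]: "Y \<in> borel_measurable M" "Y' \<in> borel_measurable M'"
    and bound: "AE \<omega> in M. \<bar>Y \<omega>\<bar> \<le> 1" "AE \<omega> in M'. \<bar>Y' \<omega>\<bar> \<le> 1"
    and moments: "\<And>n::nat. (\<integral>\<omega>. Y \<omega> ^ n \<partial>M) = (\<integral>\<omega>. Y' \<omega> ^ n \<partial>M')"
  shows "distr M borel Y = distr M' borel Y'"
proof (rule Levy_uniqueness)
  interpret M: prob_space M by fact
  interpret M': prob_space M' by fact
  show "real_distribution (distr M borel Y)" "real_distribution (distr M' borel Y')"
    by auto
  have char_limit: "(\<lambda>n. \<Sum>k\<le>n. ((\<i> * complex_of_real t)^k / fact k) * complex_of_real (\<integral>\<omega>. V \<omega> ^ k \<partial>Q))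
      \<longlonglongrightarrow> char (distr Q borel V) t"
    if "prob_space Q" and [measurable]: "V \<in> borel_measurable Q" and b: "AE \<omega> in Q. \<bar>V \<omega>\<bar> \<le> 1"
    for Q :: "'c measure" and V :: "'c \<Rightarrow> real" and t :: real
  proof -
    interpret Q: prob_space Q by fact
    have le1: "AE \<omega> in Q. \<bar>V \<omega>\<bar> ^ k \<le> 1" for k
      using b by eventually_elim (auto intro: power_le_one)
    have int: "integrable Q (\<lambda>\<omega>. V \<omega> ^ k)" for k
      using le1[of k] by (intro Q.integrable_const_bound[of _ 1]) (auto simp: power_abs)
    have absle: "(\<integral>\<omega>. \<bar>V \<omega>\<bar> ^ k \<partial>Q) \<le> 1" for k
    proof -
      have "(\<integral>\<omega>. \<bar>V \<omega>\<bar> ^ k \<partial>Q) \<le> (\<integral>\<omega>. 1 \<partial>Q)"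
        using le1[of k] integrable_abs[OF int[of k]] by (intro integral_mono_AE) (auto simp: power_abs)
      then show ?thesis by (simp add: Q.prob_space)
    qed
    have approx: "cmod (char (distr Q borel V) t - (\<Sum>k\<le>n. ((\<i> * t)^k / fact k) * (\<integral>\<omega>. V \<omega> ^ k \<partial>Q)))
        \<le> 2 * (\<bar>t\<bar> ^ n / fact n)" for n
    proof -
      have "cmod (char (distr Q borel V) t - (\<Sum>k\<le>n. ((\<i> * t)^k / fact k) * (\<integral>\<omega>. V \<omega> ^ k \<partial>Q)))
        \<le> (2 * \<bar>t\<bar> ^ n / fact n) * (\<integral>\<omega>. \<bar>V \<omega>\<bar> ^ n \<partial>Q)"
        by (rule Q.char_approx1') (auto simp: int)
      also have "\<dots> \<le> (2 * \<bar>t\<bar> ^ n / fact n) * 1"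
        using absle by (intro mult_left_mono) auto
      finally show ?thesis by simp
    qed
    have "(\<lambda>n. 2 * (\<bar>t\<bar> ^ n / fact n)) \<longlonglongrightarrow> 0"
      using summable_LIMSEQ_zero[OF summable_exp[of "\<bar>t\<bar>"]]
      by (intro tendsto_mult_right_zero) (simp add: divide_inverse mult.commute)
    then have "(\<lambda>n. char (distr Q borel V) t - (\<Sum>k\<le>n. ((\<i> * t)^k / fact k) * (\<integral>\<omega>. V \<omega> ^ k \<partial>Q))) \<longlonglongrightarrow> 0"
      by (rule Lim_null_comparison[OF always_eventually, rotated]) (use approx in auto)
    from tendsto_diff[OF tendsto_const[of "char (distr Q borel V) t"] this]
    show ?thesis by simp
  qed
  show "char (distr M borel Y) = char (distr M' borel Y')"
  proof
    fix t
    from char_limit[OF assms(1,3) bound(1), of t] char_limit[OF assms(2,4) bound(2), of t]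
    show "char (distr M borel Y) t = char (distr M' borel Y') t"
      unfolding moments by (rule LIMSEQ_unique)
  qed
qed

text \<open>The Laplace transform at the integer \<open>n\<close> is the \<open>n\<close>-th moment
  of \<open>exp (- Y)\<close>, which almost surely lies in the unit interval; applying
  \<open>- ln\<close> afterwards recovers the law of \<open>Y\<close>.\<close>

lemma laplace_transform_determines_distr:
  fixes Y :: "'a \<Rightarrow> real" and Y' :: "'b \<Rightarrow> real"
  assumes "prob_space M" "prob_space M'"
    and [measurable]: "Y \<in> borel_measurable M" "Y' \<in> borel_measurable M'"
    and nonneg: "AE \<omega> in M. 0 \<le> Y \<omega>" "AE \<omega> in M'. 0 \<le> Y' \<omega>"
    and laplace: "\<And>\<xi>. 0 \<le> \<xi> \<Longrightarrow> (\<integral>\<omega>. exp (- \<xi> * Y \<omega>) \<partial>M) = (\<integral>\<omega>. exp (- \<xi> * Y' \<omega>) \<partial>M')"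
  shows "distr M borel Y = distr M' borel Y'"
proof -
  have "distr M borel (\<lambda>\<omega>. exp (- Y \<omega>)) = distr M' borel (\<lambda>\<omega>. exp (- Y' \<omega>))"
  proof (rule moments_determine_distr_bounded[OF assms(1,2)])
    show "(\<integral>\<omega>. exp (- Y \<omega>) ^ n \<partial>M) = (\<integral>\<omega>. exp (- Y' \<omega>) ^ n \<partial>M')" for n
      using laplace[of "real n"] by (simp add: exp_of_nat_mult[symmetric])
  qed (use nonneg in auto)
  then have "distr (distr M borel (\<lambda>\<omega>. exp (- Y \<omega>))) borel (\<lambda>y. - ln y)
      = distr (distr M' borel (\<lambda>\<omega>. exp (- Y' \<omega>))) borel (\<lambda>y. - ln y)"
    by simp
  then show ?thesis
    by (subst (asm) (1 2) distr_distr) (auto simp: comp_def)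
qed

section \<open>Paths and tails of a stable subordinator\<close>

context prob_space
begin

lemma stable_subordinator_measurable:
  "stable_subordinator \<nu> D \<Longrightarrow> 0 \<le> s \<Longrightarrow> D s \<in> borel_measurable M"
  by (simp add: stable_subordinator_def)

lemma stable_subordinator_mono:
  "stable_subordinator \<nu> D \<Longrightarrow> AE \<omega> in M. mono_on {0..} (\<lambda>t. D t \<omega>)"
  unfolding stable_subordinator_def nondecreasing_cadlag_def by auto

lemma stable_subordinator_nonneg:
  assumes "stable_subordinator \<nu> D" "0 \<le> s"
  shows "AE \<omega> in M. 0 \<le> D s \<omega>"
proof -
  have "AE \<omega> in M. D 0 \<omega> = 0" using assms by (simp add: stable_subordinator_def)
  with stable_subordinator_mono[OF assms(1)] show ?thesis
    by eventually_elim (use assms(2) in \<open>auto dest: mono_onD[of _ _ 0 s]\<close>)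
qed

lemma stable_subordinator_laplace:
  "stable_subordinator \<nu> D \<Longrightarrow> 0 \<le> s \<Longrightarrow> 0 \<le> \<xi> \<Longrightarrow>
    expectation (\<lambda>\<omega>. exp (- \<xi> * D s \<omega>)) = exp (- s * \<xi> powr \<nu>)"
  unfolding stable_subordinator_def by blast

text \<open>Markov's inequality for \<open>exp (- D s)\<close>, with the Laplace transform taken at
  1, where \<open>\<nu>\<close> drops out.\<close>

lemma stable_subordinator_tail:
  assumes "stable_subordinator \<nu> D" "0 \<le> s"
  shows "prob {\<omega> \<in> space M. D s \<omega> \<le> t} \<le> exp (t - s)"
proof -
  have [measurable]: "D s \<in> borel_measurable M"
    using assms by (rule stable_subordinator_measurable)
  have int: "integrable M (\<lambda>\<omega>. exp (- D s \<omega>))"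
    using stable_subordinator_nonneg[OF assms] by (intro integrable_const_bound[of _ 1]) auto
  have "prob {\<omega> \<in> space M. exp (- t) \<le> exp (- D s \<omega>)} \<le> expectation (\<lambda>\<omega>. exp (- D s \<omega>)) / exp (- t)"
    using integral_Markov_inequality_measure[OF int, of "{}" "exp (-t)"] by simp
  also have "\<dots> = exp (t - s)"
    using stable_subordinator_laplace[OF assms, of 1] by (simp add: exp_diff exp_minus field_simps)
  finally show ?thesis by simp
qed

text \<open>This makes the infimum defining the inverse run over a nonempty set. For an integer
  level \<open>m\<close>, staying below \<open>m\<close> at all integer times has probability at
  most \<open>exp (m - n)\<close> for every \<open>n\<close>, hence 0; countably many levels
  suffice.\<close>

lemma stable_subordinator_unbounded:
  assumes "stable_subordinator \<nu> D"
  shows "AE \<omega> in M. \<forall>t. \<exists>s\<ge>0. t < D s \<omega>"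
proof -
  have [measurable]: "D (real n) \<in> borel_measurable M" for n :: nat
    using assms by (simp add: stable_subordinator_measurable)
  have "AE \<omega> in M. \<exists>n::nat. real m < D (real n) \<omega>" for m :: nat
  proof (rule AE_I')
    let ?A = "{\<omega> \<in> space M. \<forall>n::nat. D (real n) \<omega> \<le> real m}"
    have "prob ?A \<le> exp (real m - real n)" for n :: nat
      by (rule order_trans[OF finite_measure_mono stable_subordinator_tail[OF assms, of "real n" "real m"]]) auto
    moreover have "(\<lambda>n. exp (real m - real n)) \<longlonglongrightarrow> 0"
      by real_asymp
    ultimately have "prob ?A \<le> 0"
      by (intro LIMSEQ_le_const) auto
    then have "prob ?A = 0" by (simp add: measure_le_0_iff)
    then show "?A \<in> null_sets M" by (auto intro!: null_setsI simp: emeasure_eq_measure)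
  qed (auto simp: not_less)
  then have "AE \<omega> in M. \<forall>m::nat. \<exists>n::nat. real m < D (real n) \<omega>"
    by (simp add: AE_all_countable)
  then show ?thesis
  proof eventually_elim
    case (elim \<omega>)
    show ?case
    proof
      fix t
      obtain m :: nat where "t \<le> real m" using real_arch_simple by blast
      moreover obtain n :: nat where "real m < D (real n) \<omega>" using elim by blast
      ultimately show "\<exists>s\<ge>0. t < D s \<omega>" by (intro exI[of _ "real n"]) auto
    qed
  qed
qed

end

text \<open>Both variables have Laplace transform \<open>exp (- s * (\<xi> * c) powr \<nu>)\<close>.
  Two probability spaces are allowed because the process and its limit may live on different
  ones.\<close>

lemma stable_subordinator_scaling:
  assumes "prob_space M" "prob_space M'" "0 < \<nu>" "0 \<le> s" "0 \<le> c"
    and D: "prob_space.stable_subordinator M \<nu> D" and D': "prob_space.stable_subordinator M' \<nu> D'"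
  shows "distr M borel (D (c powr \<nu> * s)) = distr M' borel (\<lambda>\<omega>. c * D' s \<omega>)"
proof -
  interpret M: prob_space M by fact
  interpret M': prob_space M' by fact
  note M.stable_subordinator_measurable[OF D, measurable] M'.stable_subordinator_measurable[OF D', measurable]
  have s: "0 \<le> c powr \<nu> * s" using assms by simp
  show ?thesis
  proof (rule laplace_transform_determines_distr)
    show "AE \<omega> in M. 0 \<le> D (c powr \<nu> * s) \<omega>"
      by (rule M.stable_subordinator_nonneg[OF D s])
    show "AE \<omega> in M'. 0 \<le> c * D' s \<omega>"
      using M'.stable_subordinator_nonneg[OF D' \<open>0 \<le> s\<close>] assms by auto
    fix \<xi> :: real assume "0 \<le> \<xi>"
    have "M.expectation (\<lambda>\<omega>. exp (- \<xi> * D (c powr \<nu> * s) \<omega>)) = exp (- (c powr \<nu> * s) * \<xi> powr \<nu>)"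
      using M.stable_subordinator_laplace[OF D s \<open>0 \<le> \<xi>\<close>] .
    also have "\<dots> = exp (- s * (\<xi> * c) powr \<nu>)"
      using \<open>0 \<le> \<xi>\<close> assms by (simp add: powr_mult mult_ac)
    also have "\<dots> = M'.expectation (\<lambda>\<omega>. exp (- (\<xi> * c) * D' s \<omega>))"
      using M'.stable_subordinator_laplace[OF D' \<open>0 \<le> s\<close>, of "\<xi> * c"] \<open>0 \<le> \<xi>\<close> \<open>0 \<le> c\<close> by simp
    finally show "M.expectation (\<lambda>\<omega>. exp (- \<xi> * D (c powr \<nu> * s) \<omega>)) =
        M'.expectation (\<lambda>\<omega>. exp (- \<xi> * (c * D' s \<omega>)))"
      by (simp add: mult_ac)
  qed (use assms s in auto)
qed

section \<open>Self-similarity of the inverse subordinator\<close>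

text \<open>For \<open>b > a\<close> the closed half-line up to \<open>a\<close> lies in the open
  one up to \<open>b\<close>, so \<open>cdf P a \<le> cdf Q b\<close>; right-continuity of
  \<open>cdf Q\<close> lets \<open>b\<close> decrease to \<open>a\<close>.\<close>

lemma real_distribution_cdf_le:
  assumes "real_distribution P" "real_distribution Q"
    and "\<And>s. measure P {..<s} \<le> cdf Q s"
  shows "cdf P a \<le> cdf Q a"
proof -
  interpret P: real_distribution P by fact
  interpret Q: real_distribution Q by fact
  have "(cdf Q \<longlongrightarrow> cdf Q a) (at_right a)"
    using Q.cdf_is_right_cont[of a] by (simp add: continuous_within)
  moreover have "\<forall>\<^sub>F b in at_right a. cdf P a \<le> cdf Q b"
    using eventually_at_right_less[of a]
  proof eventually_elim
    case (elim b)
    have "cdf P a \<le> measure P {..<b}"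
      unfolding cdf_def using elim by (intro P.finite_measure_mono) auto
    with assms(3)[of b] show ?case by simp
  qed
  ultimately show ?thesis
    by (rule tendsto_lowerbound) simp
qed

lemma real_distribution_eqI_cdf_sandwich:
  assumes "real_distribution P" "real_distribution Q"
    and "\<And>s. measure P {..<s} \<le> cdf Q s" "\<And>s. measure Q {..<s} \<le> cdf P s"
  shows "P = Q"
  using assms by (intro cdf_unique ext antisym real_distribution_cdf_le)

context prob_space
begin

lemma inverse_stable_subordinator_measurable:
  "inverse_stable_subordinator \<nu> L \<Longrightarrow> 0 \<le> t \<Longrightarrow> L t \<in> borel_measurable M"
  by (simp add: inverse_stable_subordinator_def)

lemma inverse_stable_subordinator_nonneg:
  assumes "inverse_stable_subordinator \<nu> L" "0 \<le> t"
  shows "AE \<omega> in M. 0 \<le> L t \<omega>"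
proof -
  obtain D where D: "stable_subordinator \<nu> D"
    and L: "AE \<omega> in M. \<forall>t\<ge>0. L t \<omega> = Inf {s. 0 \<le> s \<and> D s \<omega> > t}"
    using assms(1) unfolding inverse_stable_subordinator_def by auto
  from L stable_subordinator_unbounded[OF D] show ?thesis
  proof eventually_elim
    case (elim \<omega>)
    \<comment> \<open>\<open>cInf_greatest\<close> needs a nonempty set: this is where unboundedness
      of the paths enters.\<close>
    then have "{s. 0 \<le> s \<and> D s \<omega> > t} \<noteq> {}" by auto
    then have "0 \<le> Inf {s. 0 \<le> s \<and> D s \<omega> > t}" by (intro cInf_greatest) auto
    with elim assms(2) show ?case by simp
  qed
qed

text \<open>Each inequality can lose the event \<open>L t = s\<close>: the path of \<open>D\<close> may exceed \<open>t\<close> exactly at time \<open>s\<close>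
  or only right after it.\<close>

lemma inverse_stable_subordinator_sandwich:
  assumes "inverse_stable_subordinator \<nu> L"
  obtains D where "stable_subordinator \<nu> D"
    and "\<And>s t. 0 \<le> s \<Longrightarrow> 0 \<le> t \<Longrightarrow>
      prob {\<omega> \<in> space M. L t \<omega> < s} \<le> prob {\<omega> \<in> space M. t < D s \<omega>} \<and>
      prob {\<omega> \<in> space M. t < D s \<omega>} \<le> prob {\<omega> \<in> space M. L t \<omega> \<le> s}"
proof -
  obtain D where D: "stable_subordinator \<nu> D"
    and L: "AE \<omega> in M. \<forall>t\<ge>0. L t \<omega> = Inf {s. 0 \<le> s \<and> D s \<omega> > t}"
    using assms unfolding inverse_stable_subordinator_def by auto
  note [measurable] = stable_subordinator_measurable[OF D]
    inverse_stable_subordinator_measurable[OF assms]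
  have iff: "AE \<omega> in M. (L t \<omega> < s \<longrightarrow> t < D s \<omega>) \<and> (t < D s \<omega> \<longrightarrow> L t \<omega> \<le> s)"
    if "0 \<le> s" "0 \<le> t" for s t
    using L stable_subordinator_unbounded[OF D] stable_subordinator_mono[OF D]
  proof eventually_elim
    case (elim \<omega>)
    let ?S = "{s. 0 \<le> s \<and> D s \<omega> > t}"
    have LS: "L t \<omega> = Inf ?S" using elim \<open>0 \<le> t\<close> by simp
    have bdd: "bdd_below ?S" by (intro bdd_belowI[of _ 0]) auto
    have "t < D s \<omega>" if "L t \<omega> < s"
    proof -
      have "?S \<noteq> {}" using elim by auto
      \<comment> \<open>Some time \<open>r\<close> before \<open>s\<close> already has
        \<open>D\<close> above \<open>t\<close>, and monotonicity carries this on to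
        \<open>s\<close>.\<close>
      with that LS obtain r where "r \<in> ?S" "r < s" using cInf_lessD by metis
      with elim(3) show ?thesis using mono_onD[OF elim(3), of r s] by auto
    qed
    moreover have "L t \<omega> \<le> s" if "t < D s \<omega>"
      unfolding LS using that \<open>0 \<le> s\<close> bdd by (intro cInf_lower) auto
    ultimately show ?case by blast
  qed
  have "prob {\<omega> \<in> space M. L t \<omega> < s} \<le> prob {\<omega> \<in> space M. t < D s \<omega>} \<and>
      prob {\<omega> \<in> space M. t < D s \<omega>} \<le> prob {\<omega> \<in> space M. L t \<omega> \<le> s}"
    if st: "0 \<le> s" "0 \<le> t" for s t
  proof
    show "prob {\<omega> \<in> space M. L t \<omega> < s} \<le> prob {\<omega> \<in> space M. t < D s \<omega>}"
      by (intro finite_measure_mono_AE) (use iff[OF st] st in auto)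
    show "prob {\<omega> \<in> space M. t < D s \<omega>} \<le> prob {\<omega> \<in> space M. L t \<omega> \<le> s}"
      by (intro finite_measure_mono_AE) (use iff[OF st] st in auto)
  qed
  with D show thesis by (rule that)
qed

end

text \<open>With \<open>s = t powr \<nu> * r\<close>, the events \<open>{D s > t}\<close> and
  \<open>{D' r > 1}\<close> have equal probability by scaling. Each lies, in probability, between
  the open and the closed lower event of its own inverse process, so the two laws bound each other
  up to the boundary point, which \<open>real_distribution_eqI_cdf_sandwich\<close> absorbs.\<close>

lemma inverse_stable_subordinator_scaling:
  assumes "prob_space M" "prob_space M'" "0 < \<nu>" "0 < t"
    and L: "prob_space.inverse_stable_subordinator M \<nu> L"
    and L': "prob_space.inverse_stable_subordinator M' \<nu> L'"
  shows "distr M borel (L t) = distr M' borel (\<lambda>\<omega>. t powr \<nu> * L' 1 \<omega>)"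
proof -
  interpret M: prob_space M by fact
  interpret M': prob_space M' by fact
  have t: "0 \<le> t" using assms by simp
  note [measurable] = M.inverse_stable_subordinator_measurable[OF L t]
  have [measurable]: "L' 1 \<in> borel_measurable M'"
    by (rule M'.inverse_stable_subordinator_measurable[OF L']) simp
  obtain D where D: "M.stable_subordinator \<nu> D"
    and LD: "\<And>s t. 0 \<le> s \<Longrightarrow> 0 \<le> t \<Longrightarrow>
      M.prob {\<omega> \<in> space M. L t \<omega> < s} \<le> M.prob {\<omega> \<in> space M. t < D s \<omega>} \<and>
      M.prob {\<omega> \<in> space M. t < D s \<omega>} \<le> M.prob {\<omega> \<in> space M. L t \<omega> \<le> s}"
    by (rule M.inverse_stable_subordinator_sandwich[OF L]) blast
  obtain D' where D': "M'.stable_subordinator \<nu> D'"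
    and LD': "\<And>s t. 0 \<le> s \<Longrightarrow> 0 \<le> t \<Longrightarrow>
      M'.prob {\<omega> \<in> space M'. L' t \<omega> < s} \<le> M'.prob {\<omega> \<in> space M'. t < D' s \<omega>} \<and>
      M'.prob {\<omega> \<in> space M'. t < D' s \<omega>} \<le> M'.prob {\<omega> \<in> space M'. L' t \<omega> \<le> s}"
    by (rule M'.inverse_stable_subordinator_sandwich[OF L']) blast
  have G: "M.prob {\<omega> \<in> space M. t < D (t powr \<nu> * s) \<omega>} = M'.prob {\<omega> \<in> space M'. 1 < D' s \<omega>}"
    if s: "0 \<le> s" for s
  proof -
    have [measurable]: "D (t powr \<nu> * s) \<in> borel_measurable M" "D' s \<in> borel_measurable M'"
      using s by (auto intro: M.stable_subordinator_measurable[OF D] M'.stable_subordinator_measurable[OF D'])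
    have "M.prob {\<omega> \<in> space M. t < D (t powr \<nu> * s) \<omega>} = measure (distr M borel (D (t powr \<nu> * s))) {t<..}"
      by (subst measure_distr) (auto intro!: arg_cong[where f=M.prob])
    also have "\<dots> = measure (distr M' borel (\<lambda>\<omega>. t * D' s \<omega>)) {t<..}"
      using stable_subordinator_scaling[OF assms(1,2,3) s t D D'] by simp
    also have "\<dots> = M'.prob {\<omega> \<in> space M'. 1 < D' s \<omega>}"
      using \<open>0 < t\<close> by (subst measure_distr) (auto intro!: arg_cong[where f=M'.prob])
    finally show ?thesis .
  qed
  have pos: "0 < t powr \<nu>" using assms by simp
  show ?thesis
  proof (rule real_distribution_eqI_cdf_sandwich)
    fix s :: real
    define r where "r = s / t powr \<nu>"
    have s: "s = t powr \<nu> * r" using pos by (simp add: r_def)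
    have m: "measure (distr M borel (L t)) {..<s} = M.prob {\<omega> \<in> space M. L t \<omega> < s}"
      "cdf (distr M borel (L t)) s = M.prob {\<omega> \<in> space M. L t \<omega> \<le> s}"
      by (auto simp: cdf_def measure_distr intro!: arg_cong[where f=M.prob])
    have m': "measure (distr M' borel (\<lambda>\<omega>. t powr \<nu> * L' 1 \<omega>)) {..<s} = M'.prob {\<omega> \<in> space M'. L' 1 \<omega> < r}"
      "cdf (distr M' borel (\<lambda>\<omega>. t powr \<nu> * L' 1 \<omega>)) s = M'.prob {\<omega> \<in> space M'. L' 1 \<omega> \<le> r}"
      using pos by (auto simp: cdf_def measure_distr s intro!: arg_cong[where f=M'.prob])
    show "measure (distr M borel (L t)) {..<s} \<le> cdf (distr M' borel (\<lambda>\<omega>. t powr \<nu> * L' 1 \<omega>)) s"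
    proof (cases "0 \<le> s")
      case True
      then have "0 \<le> r" by (simp add: r_def)
      from LD[OF True t] LD'[OF this, of 1] G[OF this] show ?thesis
        unfolding m m' s[symmetric] by simp
    next
      \<comment> \<open>The comparison with \<open>D\<close> is available only at nonnegative times;
        below 0 the left-hand side vanishes.\<close>
      case False
      have "M.prob {\<omega> \<in> space M. L t \<omega> < s} = 0"
        using M.inverse_stable_subordinator_nonneg[OF L t] False
        by (intro M.prob_eq_0_AE) auto
      then show ?thesis unfolding m m' by simp
    qed
    show "measure (distr M' borel (\<lambda>\<omega>. t powr \<nu> * L' 1 \<omega>)) {..<s} \<le> cdf (distr M borel (L t)) s"
    proof (cases "0 \<le> s")
      case True
      then have "0 \<le> r" by (simp add: r_def)
      from LD[OF True t] LD'[OF this, of 1] G[OF this] show ?thesis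
        unfolding m m' s[symmetric] by simp
    next
      case False
      then have "r < 0" using pos by (simp add: r_def divide_neg_pos)
      then have "M'.prob {\<omega> \<in> space M'. L' 1 \<omega> < r} = 0"
        using M'.inverse_stable_subordinator_nonneg[OF L', of 1]
        by (intro M'.prob_eq_0_AE) auto
      then show ?thesis unfolding m m' by simp
    qed
  qed auto
qed

section \<open>Independent random indices\<close>

context prob_space
begin

text \<open>The events \<open>T = k\<close> partition the space, so for each outcome only one term
  of the series is nonzero. Integration term by term is justified because the \<open>k\<close>-th
  term has mean norm at most the probability of \<open>T = k\<close>, which is summable.\<close>

lemma expectation_nat_index_sums:
  fixes T :: "'a \<Rightarrow> nat" and W :: "nat \<Rightarrow> 'a \<Rightarrow> complex"
  assumes T [measurable]: "T \<in> measurable M (count_space UNIV)"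
    and W [measurable]: "\<And>k. W k \<in> borel_measurable M"
    and bound: "\<And>k. AE \<omega> in M. norm (W k \<omega>) \<le> 1"
  shows "(\<lambda>k. expectation (\<lambda>\<omega>. of_bool (T \<omega> = k) * W k \<omega>)) sums expectation (\<lambda>\<omega>. W (T \<omega>) \<omega>)"
proof -
  define f where "f k \<omega> = of_bool (T \<omega> = k) * W k \<omega>" for k \<omega>
  have [measurable]: "f k \<in> borel_measurable M" for k
    unfolding f_def by measurable
  have le: "AE \<omega> in M. norm (f k \<omega>) \<le> indicator {\<omega> \<in> space M. T \<omega> = k} \<omega>" for k
    using bound[of k] AE_space by eventually_elim (auto simp: f_def norm_mult)
  have int: "integrable M (f k)" for k
    using bound[of k] by (intro integrable_const_bound[of _ 1]) (auto simp: f_def norm_mult)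
  have single: "(\<lambda>k. norm (f k \<omega>)) sums norm (W (T \<omega>) \<omega>)" "(\<lambda>k. f k \<omega>) sums W (T \<omega>) \<omega>" for \<omega>
  proof -
    have "(\<lambda>k. norm (f k \<omega>)) = (\<lambda>k. if k = T \<omega> then norm (W k \<omega>) else 0)"
      "(\<lambda>k. f k \<omega>) = (\<lambda>k. if k = T \<omega> then W k \<omega> else 0)"
      by (auto simp: f_def fun_eq_iff)
    then show "(\<lambda>k. norm (f k \<omega>)) sums norm (W (T \<omega>) \<omega>)" "(\<lambda>k. f k \<omega>) sums W (T \<omega>) \<omega>"
      using sums_single[of "T \<omega>" "\<lambda>k. norm (W k \<omega>)"] sums_single[of "T \<omega>" "\<lambda>k. W k \<omega>"] by simp_all
  qed
  have "(\<lambda>k. expectation (f k)) sums (\<integral>\<omega>. (\<Sum>k. f k \<omega>) \<partial>M)"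
  proof (rule sums_integral)
    have "(\<lambda>k. prob {\<omega> \<in> space M. T \<omega> = k}) sums prob (\<Union>k. {\<omega> \<in> space M. T \<omega> = k})"
      by (intro finite_measure_UNION) (auto simp: disjoint_family_on_def)
    then have smb: "summable (\<lambda>k. prob {\<omega> \<in> space M. T \<omega> = k})"
      by (rule sums_summable)
    have norm_le: "norm (\<integral>\<omega>. norm (f k \<omega>) \<partial>M) \<le> prob {\<omega> \<in> space M. T \<omega> = k}" for k
    proof -
      have "integrable M (indicator {\<omega> \<in> space M. T \<omega> = k} :: 'a \<Rightarrow> real)"
        by (intro integrable_const_bound[of _ 1]) auto
      then have "(\<integral>\<omega>. norm (f k \<omega>) \<partial>M) \<le> (\<integral>\<omega>. indicator {\<omega> \<in> space M. T \<omega> = k} \<omega> \<partial>M)"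
        using le[of k] int[of k] by (intro integral_mono_AE integrable_norm)
      then show ?thesis by (simp add: integral_nonneg_AE)
    qed
    show "summable (\<lambda>k. \<integral>\<omega>. norm (f k \<omega>) \<partial>M)"
      by (rule summable_comparison_test'[OF smb norm_le])
  qed (use int single in \<open>auto intro: sums_summable\<close>)
  also have "(\<lambda>\<omega>. \<Sum>k. f k \<omega>) = (\<lambda>\<omega>. W (T \<omega>) \<omega>)"
    using single(2) by (auto simp: sums_iff fun_eq_iff)
  finally show ?thesis by (simp add: f_def[abs_def])
qed

text \<open>\<^const>\<open>indep_var\<close> requires a common value type, hence the complex-valued indicators of \<open>T\<close>.\<close>

lemma expectation_indep_nat_index:
  fixes T :: "'a \<Rightarrow> nat" and W :: "nat \<Rightarrow> 'a \<Rightarrow> complex"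
  assumes T [measurable]: "T \<in> measurable M (count_space UNIV)"
    and indep: "\<And>k. indep_var borel (\<lambda>\<omega>. of_bool (T \<omega> = k)) borel (W k)"
    and bound: "\<And>k. AE \<omega> in M. norm (W k \<omega>) \<le> 1"
  shows "expectation (\<lambda>\<omega>. W (T \<omega>) \<omega>) = expectation (\<lambda>\<omega>. expectation (W (T \<omega>)))"
proof -
  have W [measurable]: "W k \<in> borel_measurable M" for k
    by (rule indep_var_rv2[OF indep])
  have int: "integrable M (W k)" for k
    using bound by (intro integrable_const_bound[of _ 1]) auto
  have norm1: "norm (expectation (W k)) \<le> 1" for k
  proof -
    have "norm (expectation (W k)) \<le> (\<integral>\<omega>. norm (W k \<omega>) \<partial>M)"
      by (rule integral_norm_bound)
    also have "\<dots> \<le> (\<integral>\<omega>. 1 \<partial>M)"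
      using bound[of k] int[of k] by (intro integral_mono_AE) auto
    finally show ?thesis by (simp add: prob_space)
  qed
  have "expectation (\<lambda>\<omega>. of_bool (T \<omega> = k) * W k \<omega>) = expectation (\<lambda>\<omega>. of_bool (T \<omega> = k) * expectation (W k))"
    for k
  proof -
    have "integrable M (\<lambda>\<omega>. of_bool (T \<omega> = k) :: complex)"
      by (intro integrable_const_bound[of _ 1]) auto
    then show ?thesis
      using int indep by (simp add: indep_var_lebesgue_integral)
  qed
  \<comment> \<open>The series expansion is used twice, once for \<open>W k\<close> and once for the
    constants \<open>expectation (W k)\<close>. Independence makes the terms agree, hence also the
    sums.\<close>
  moreover have "(\<lambda>k. expectation (\<lambda>\<omega>. of_bool (T \<omega> = k) * W k \<omega>)) sums expectation (\<lambda>\<omega>. W (T \<omega>) \<omega>)"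
    using bound by (intro expectation_nat_index_sums) auto
  moreover have "(\<lambda>k. expectation (\<lambda>\<omega>. of_bool (T \<omega> = k) * expectation (W k)))
      sums expectation (\<lambda>\<omega>. expectation (W (T \<omega>)))"
    using norm1 by (intro expectation_nat_index_sums) auto
  ultimately show ?thesis
    by (simp add: sums_unique2)
qed

lemma poisson_pgf:
  fixes z :: complex
  assumes T [measurable]: "T \<in> measurable M (count_space UNIV)" and "0 < r" and z: "norm z \<le> 1"
    and pmf: "\<And>k. prob {\<omega> \<in> space M. T \<omega> = k} = pmf (poisson_pmf r) k"
  shows "expectation (\<lambda>\<omega>. z ^ T \<omega>) = exp (r * (z - 1))"
proof -
  have ev: "expectation (\<lambda>\<omega>. of_bool (T \<omega> = k) * z ^ k) = exp (- complex_of_real r) * ((r * z) ^ k /\<^sub>R fact k)" for k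
  proof -
    have "expectation (\<lambda>\<omega>. of_bool (T \<omega> = k) * z ^ k) = expectation (\<lambda>\<omega>. of_bool (T \<omega> = k)) * z ^ k"
      by (simp only: integral_mult_left_zero)
    also have "expectation (\<lambda>\<omega>. of_bool (T \<omega> = k) :: complex)
        = expectation (\<lambda>\<omega>. complex_of_real (indicator {\<omega> \<in> space M. T \<omega> = k} \<omega>))"
      by (intro Bochner_Integration.integral_cong) auto
    also have "\<dots> = complex_of_real (prob {\<omega> \<in> space M. T \<omega> = k})"
      unfolding integral_complex_of_real by simp
    also have "\<dots> = complex_of_real (r ^ k / fact k * exp (- r))"
      unfolding pmf using \<open>0 < r\<close> by simp
    also have "\<dots> = of_real r ^ k / fact k * exp (- complex_of_real r)"
      using exp_of_real[of "- r", where 'a=complex] by simp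
    finally show ?thesis
      by (simp add: scaleR_conv_of_real power_mult_distrib divide_inverse mult_ac)
  qed
  have "(\<lambda>k. expectation (\<lambda>\<omega>. of_bool (T \<omega> = k) * z ^ k)) sums expectation (\<lambda>\<omega>. z ^ T \<omega>)"
    using z by (intro expectation_nat_index_sums) (auto simp: norm_power intro: power_le_one)
  moreover have "(\<lambda>k. exp (- complex_of_real r) * ((r * z) ^ k /\<^sub>R fact k)) sums (exp (- complex_of_real r) * exp (r * z))"
    by (rule sums_mult) (rule exp_converges)
  ultimately have "expectation (\<lambda>\<omega>. z ^ T \<omega>) = exp (- complex_of_real r) * exp (r * z)"
    unfolding ev by (rule sums_unique2)
  then show ?thesis
    by (simp add: exp_add[symmetric] algebra_simps)
qed

text \<open>Measurability of \<open>V\<close> with respect to the sigma-algebra generated by the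
  whole family \<open>Y\<close> lets \<open>V\<close> depend on many members at once, such as a
  partial sum. The map \<open>U\<close> makes room for indicators of events determined by a single
  \<open>X i\<close>.\<close>

lemma indep_families_indep_var:
  assumes fam: "indep_families I E X J F Y" and "i \<in> I"
    and V: "V \<in> measurable (sigma (space M) {Y j -` B \<inter> space M | j B. j \<in> J \<and> B \<in> sets F}) K"
    and rv: "V \<in> measurable M K" and U: "U \<in> measurable E H"
  shows "indep_var H (\<lambda>\<omega>. U (X i \<omega>)) K V"
proof -
  let ?A = "{X i -` A \<inter> space M | i A. i \<in> I \<and> A \<in> sets E}"
  let ?B = "{Y j -` B \<inter> space M | j B. j \<in> J \<and> B \<in> sets F}"
  have Xi: "X i \<in> measurable M E"
    and ind: "indep_set (sigma_sets (space M) ?A) (sigma_sets (space M) ?B)"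
    using fam \<open>i \<in> I\<close> by (auto simp: indep_families_def)
  have "(\<lambda>\<omega>. U (X i \<omega>)) -` C \<inter> space M \<in> sigma_sets (space M) ?A" if "C \<in> sets H" for C
  proof -
    have "(\<lambda>\<omega>. U (X i \<omega>)) -` C \<inter> space M = X i -` (U -` C \<inter> space E) \<inter> space M"
      using measurable_space[OF Xi] by auto
    also have "\<dots> \<in> ?A" using measurable_sets[OF U that] \<open>i \<in> I\<close> by blast
    finally show ?thesis by (rule sigma_sets.Basic)
  qed
  then have 1: "sigma_sets (space M) {(\<lambda>\<omega>. U (X i \<omega>)) -` C \<inter> space M | C. C \<in> sets H} \<subseteq> sigma_sets (space M) ?A"
    by (intro sigma_sets_mono) auto
  have B: "?B \<subseteq> Pow (space M)" by auto
  have "V -` C \<inter> space M \<in> sigma_sets (space M) ?B" if "C \<in> sets K" for C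
    using measurable_sets[OF V that] B by (simp add: space_measure_of)
  then have 2: "sigma_sets (space M) {V -` C \<inter> space M | C. C \<in> sets K} \<subseteq> sigma_sets (space M) ?B"
    by (intro sigma_sets_mono) auto
  have "indep_set (sigma_sets (space M) {(\<lambda>\<omega>. U (X i \<omega>)) -` C \<inter> space M | C. C \<in> sets H})
      (sigma_sets (space M) {V -` C \<inter> space M | C. C \<in> sets K})"
    using ind 1 2 unfolding indep_sets2_eq by blast
  then show ?thesis
    unfolding indep_var_eq using rv measurable_compose[OF Xi U] by auto
qed

lemma indep_set_commute:
  assumes "indep_set A B"
  shows "indep_set B A"
  unfolding indep_sets2_eq
proof (intro conjI ballI)
  fix b a assume "b \<in> B" "a \<in> A"
  with indep_setD[OF assms, of a b] show "prob (b \<inter> a) = prob b * prob a"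
    by (simp add: Int_commute mult.commute)
qed (use assms in \<open>auto simp: indep_sets2_eq\<close>)

lemma indep_families_commute:
  "indep_families I E X J F Y \<Longrightarrow> indep_families J F Y I E X"
  unfolding indep_families_def by (blast intro: indep_set_commute)

lemma measurable_generated_member:
  assumes "j \<in> J" "\<And>j. j \<in> J \<Longrightarrow> Y j \<in> measurable M F"
  shows "Y j \<in> measurable (sigma (space M) {Y j -` B \<inter> space M | j B. j \<in> J \<and> B \<in> sets F}) F"
proof (rule measurableI)
  let ?G = "{Y j -` B \<inter> space M | j B. j \<in> J \<and> B \<in> sets F}"
  have G: "?G \<subseteq> Pow (space M)" by auto
  show "Y j \<omega> \<in> space F" if "\<omega> \<in> space (sigma (space M) ?G)" for \<omega>
    using that assms G by (auto dest: measurable_space)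
  show "Y j -` C \<inter> space (sigma (space M) ?G) \<in> sets (sigma (space M) ?G)" if "C \<in> sets F" for C
    using that G assms(1) by (auto intro!: sigma_sets.Basic)
qed

end

section \<open>Characteristic functions of random sums\<close>

text \<open>The exponent has nonpositive real part. This supplies the dominating constant 1 in the
  later limits under the expectation.\<close>

lemma norm_exp_generator_le_1:
  fixes z :: complex
  assumes "norm z \<le> 1" "0 \<le> (a::real)"
  shows "norm (exp (a * (z - 1))) \<le> 1"
proof -
  have "Re z \<le> 1" using complex_Re_le_cmod[of z] assms by linarith
  then have "a * (Re z - 1) \<le> 0" using assms by (intro mult_nonneg_nonpos) auto
  then show ?thesis by simp
qed

context prob_space
begin

lemma poisson_process_measurable:
  "poisson_process r N \<Longrightarrow> 0 \<le> s \<Longrightarrow> N s \<in> measurable M (count_space UNIV)"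
  by (simp add: poisson_process_def)

lemma poisson_process_pgf:
  fixes z :: complex
  assumes N: "poisson_process r N" and "0 < r" "0 < s" "norm z \<le> 1"
  shows "expectation (\<lambda>\<omega>. z ^ N s \<omega>) = exp (complex_of_real (r * s) * (z - 1))"
proof (rule poisson_pgf)
  have [measurable]: "N s \<in> measurable M (count_space UNIV)" "N 0 \<in> measurable M (count_space UNIV)"
    using N \<open>0 < s\<close> by (auto intro: poisson_process_measurable)
  show "N s \<in> measurable M (count_space UNIV)" by measurable
  fix k
  have zero: "AE \<omega> in M. N 0 \<omega> = 0" using N by (simp add: poisson_process_def)
  have "{\<omega> \<in> space M. real (N s \<omega>) = real (N 0 \<omega>) + real k} \<in> events" by measurable
  then have ev: "{\<omega> \<in> space M. N s \<omega> = N 0 \<omega> + k} \<in> events" by (simp flip: of_nat_add)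
  \<comment> \<open>The Poisson law is given for increments, and \<open>N 0\<close> vanishes only
    almost surely, so the two events agree up to a null set.\<close>
  have "prob {\<omega> \<in> space M. N s \<omega> = k} = prob {\<omega> \<in> space M. N s \<omega> = N 0 \<omega> + k}"
    by (rule finite_measure_eq_AE) (use zero ev in auto)
  also have "\<dots> = pmf (poisson_pmf (r * (s - 0))) k"
    using N \<open>0 < s\<close> unfolding poisson_process_def by blast
  finally show "prob {\<omega> \<in> space M. N s \<omega> = k} = pmf (poisson_pmf (r * s)) k" by simp
qed (use assms in auto)

text \<open>The paths of \<open>N\<close> are only right-continuous, so the random time \<open>L j\<close> is approximated
  strictly from the right by times with values in a discrete set.\<close>

lemma poisson_process_random_time_pgf:
  fixes z :: complex
  assumes N: "poisson_process r N" and "0 < r" and z: "norm z \<le> 1"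
    and fam: "indep_families {0..} (count_space UNIV) N J borel L" and "j \<in> J"
    and nonneg: "AE \<omega> in M. 0 \<le> L j \<omega>"
    and T [measurable]: "T \<in> measurable M (count_space UNIV)"
    and T_eq: "AE \<omega> in M. T \<omega> = N (L j \<omega>) \<omega>"
  shows "expectation (\<lambda>\<omega>. z ^ T \<omega>) = expectation (\<lambda>\<omega>. exp (complex_of_real (r * L j \<omega>) * (z - 1)))"
proof -
  note poisson_process_measurable[OF N, measurable]
  have [measurable]: "L j \<in> borel_measurable M"
    using fam \<open>j \<in> J\<close> by (auto simp: indep_families_def)
  \<comment> \<open>\<open>K n\<close> numbers the cell of the grid with mesh
    \<open>1 / (n + 1)\<close> that contains \<open>L j\<close>.\<close>
  define K where "K n \<omega> = nat \<lfloor>real (Suc n) * L j \<omega>\<rfloor>" for n \<omega>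
  \<comment> \<open>The \<open>+ 1\<close> selects the right end of the cell: it exceeds
    \<open>L j\<close> strictly even when \<open>L j\<close> is a grid point, and it is positive, as
    \<open>poisson_process_pgf\<close> requires.\<close>
  define \<tau> where "\<tau> n k = (real k + 1) / real (Suc n)" for n k
  have \<tau>_pos: "0 < \<tau> n k" for n k by (simp add: \<tau>_def)
  have [measurable]: "K n \<in> measurable M (count_space UNIV)" for n
    unfolding K_def by measurable
  have \<tau>_K: "L j \<omega> < \<tau> n (K n \<omega>) \<and> \<tau> n (K n \<omega>) \<le> L j \<omega> + inverse (real (Suc n))"
    if "0 \<le> L j \<omega>" for n \<omega>
  proof -
    have "real (K n \<omega>) = of_int \<lfloor>real (Suc n) * L j \<omega>\<rfloor>"
      using that by (simp add: K_def)
    then have "real (Suc n) * L j \<omega> < real (K n \<omega>) + 1" "real (K n \<omega>) \<le> real (Suc n) * L j \<omega>"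
      by linarith+
    then have "L j \<omega> < (real (K n \<omega>) + 1) / real (Suc n)" "real (K n \<omega>) / real (Suc n) \<le> L j \<omega>"
      by (simp_all add: pos_less_divide_eq pos_divide_le_eq mult.commute del: of_nat_Suc)
    then show ?thesis by (simp add: \<tau>_def add_divide_distrib inverse_eq_divide del: of_nat_Suc)
  qed
  have \<tau>_lim: "(\<lambda>n. \<tau> n (K n \<omega>)) \<longlonglongrightarrow> L j \<omega>" if "0 \<le> L j \<omega>" for \<omega>
  proof (rule tendsto_sandwich[OF always_eventually always_eventually tendsto_const])
    show "(\<lambda>n. L j \<omega> + inverse (real (Suc n))) \<longlonglongrightarrow> L j \<omega>"
      using tendsto_add[OF tendsto_const LIMSEQ_inverse_real_of_nat, of "L j \<omega>"] by simp
  qed (use \<tau>_K[OF that] in \<open>auto intro: less_imp_le\<close>)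

  \<comment> \<open>The cell number is a function of \<open>L j\<close>, hence independent of
    \<open>N\<close> at each fixed grid time; the Poisson generating function then applies cell by
    cell.\<close>
  have discrete: "expectation (\<lambda>\<omega>. z ^ N (\<tau> n (K n \<omega>)) \<omega>) = expectation (\<lambda>\<omega>. exp (complex_of_real (r * \<tau> n (K n \<omega>)) * (z - 1)))"
    for n
  proof -
    have "expectation (\<lambda>\<omega>. z ^ N (\<tau> n (K n \<omega>)) \<omega>) = expectation (\<lambda>\<omega>. expectation (\<lambda>\<omega>'. z ^ N (\<tau> n (K n \<omega>)) \<omega>'))"
    proof (rule expectation_indep_nat_index)
      fix k
      have \<tau>0: "\<tau> n k \<in> {0..}" using \<tau>_pos[of n k] by simp
      have "N (\<tau> n k) \<in> measurable (sigma (space M)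
          {N s -` B \<inter> space M | s B. s \<in> {0..} \<and> B \<in> sets (count_space UNIV)}) (count_space UNIV)"
        by (rule measurable_generated_member[OF \<tau>0]) auto
      then have V: "(\<lambda>\<omega>. z ^ N (\<tau> n k) \<omega>) \<in> borel_measurable (sigma (space M)
          {N s -` B \<inter> space M | s B. s \<in> {0..} \<and> B \<in> sets (count_space UNIV)})"
        by (rule measurable_compose) simp
      show "indep_var borel (\<lambda>\<omega>. of_bool (K n \<omega> = k)) borel (\<lambda>\<omega>. z ^ N (\<tau> n k) \<omega>)"
        unfolding K_def
      proof (rule indep_families_indep_var[OF indep_families_commute[OF fam] \<open>j \<in> J\<close> V])
        have [measurable]: "N (\<tau> n k) \<in> measurable M (count_space UNIV)"
          using \<tau>0 by (intro poisson_process_measurable[OF N]) simp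
        show "(\<lambda>\<omega>. z ^ N (\<tau> n k) \<omega>) \<in> borel_measurable M" by measurable
        show "(\<lambda>x. of_bool (nat \<lfloor>real (Suc n) * x\<rfloor> = k)) \<in> borel_measurable borel" by measurable
      qed
    qed (use z in \<open>auto simp: norm_power intro!: AE_I2 power_le_one\<close>)
    then show ?thesis
      using poisson_process_pgf[OF N \<open>0 < r\<close> \<tau>_pos z] by simp
  qed

  have N_measurable: "(\<lambda>\<omega>. z ^ N (\<tau> n (K n \<omega>)) \<omega>) \<in> borel_measurable M" for n
  proof -
    have "(\<lambda>\<omega>. z ^ N (\<tau> n k) \<omega>) \<in> borel_measurable M" for k
      using \<tau>_pos[of n k] by (intro measurable_compose[OF poisson_process_measurable[OF N]]) auto
    then show ?thesis
      by (rule measurable_compose_countable) measurable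
  qed
  have cadlag: "AE \<omega> in M. \<forall>t\<ge>0. continuous (at_right t) (\<lambda>s. real (N s \<omega>))"
    using N by (auto simp: poisson_process_def nondecreasing_cadlag_def)
  have "(\<lambda>n. expectation (\<lambda>\<omega>. z ^ N (\<tau> n (K n \<omega>)) \<omega>)) \<longlonglongrightarrow> expectation (\<lambda>\<omega>. z ^ T \<omega>)"
  proof (rule integral_dominated_convergence[where w="\<lambda>_. 1"])
    show "AE \<omega> in M. (\<lambda>n. z ^ N (\<tau> n (K n \<omega>)) \<omega>) \<longlonglongrightarrow> z ^ T \<omega>"
      using nonneg T_eq cadlag
    proof eventually_elim
      case (elim \<omega>)
      have "filterlim (\<lambda>n. \<tau> n (K n \<omega>)) (at_right (L j \<omega>)) sequentially"
        using \<tau>_lim[OF elim(1)] \<tau>_K[OF elim(1)] by (intro tendsto_imp_filterlim_at_right) auto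
      moreover have "((\<lambda>s. real (N s \<omega>)) \<longlongrightarrow> real (N (L j \<omega>) \<omega>)) (at_right (L j \<omega>))"
        using elim by (simp add: continuous_within)
      ultimately have "(\<lambda>n. real (N (\<tau> n (K n \<omega>)) \<omega>)) \<longlonglongrightarrow> real (N (L j \<omega>) \<omega>)"
        by (rule filterlim_compose[rotated])
      \<comment> \<open>Counts are integers, so a distance below 1 forces equality: the values along
        the grid times are eventually constant in \<open>n\<close>.\<close>
      then have "\<forall>\<^sub>F n in sequentially. dist (real (N (\<tau> n (K n \<omega>)) \<omega>)) (real (N (L j \<omega>) \<omega>)) < 1"
        by (rule tendstoD) simp
      then have "\<forall>\<^sub>F n in sequentially. z ^ N (\<tau> n (K n \<omega>)) \<omega> = z ^ T \<omega>"
      proof eventually_elim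
        case (elim n)
        then have "N (\<tau> n (K n \<omega>)) \<omega> = N (L j \<omega>) \<omega>" unfolding dist_real_def by linarith
        with \<open>T \<omega> = N (L j \<omega>) \<omega>\<close> show ?case by simp
      qed
      then show ?case by (rule tendsto_eventually)
    qed
  qed (use z N_measurable in \<open>auto simp: norm_power intro!: AE_I2 power_le_one\<close>)
  moreover have "(\<lambda>n. expectation (\<lambda>\<omega>. exp (complex_of_real (r * \<tau> n (K n \<omega>)) * (z - 1))))
      \<longlonglongrightarrow> expectation (\<lambda>\<omega>. exp (complex_of_real (r * L j \<omega>) * (z - 1)))"
  proof (rule integral_dominated_convergence[where w="\<lambda>_. 1"])
    show "AE \<omega> in M. (\<lambda>n. exp (complex_of_real (r * \<tau> n (K n \<omega>)) * (z - 1))) \<longlonglongrightarrow> exp (complex_of_real (r * L j \<omega>) * (z - 1))"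
      using nonneg by eventually_elim (intro tendsto_intros \<tau>_lim)
    show "AE \<omega> in M. norm (exp (complex_of_real (r * \<tau> n (K n \<omega>)) * (z - 1))) \<le> 1" for n
    proof (rule AE_I2)
      fix \<omega>
      have "0 \<le> r * \<tau> n (K n \<omega>)" using \<open>0 < r\<close> \<tau>_pos[of n "K n \<omega>"] by simp
      from norm_exp_generator_le_1[OF z this]
      show "norm (exp (complex_of_real (r * \<tau> n (K n \<omega>)) * (z - 1))) \<le> 1" by simp
    qed
    show "(\<lambda>\<omega>. exp (complex_of_real (r * \<tau> n (K n \<omega>)) * (z - 1))) \<in> borel_measurable M" for n
      unfolding \<tau>_def by measurable
  qed auto
  ultimately show ?thesis
    unfolding discrete by (rule LIMSEQ_unique)
qed

lemma random_sum_measurable: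
  fixes X :: "nat \<Rightarrow> 'a \<Rightarrow> real"
  assumes T: "T \<in> measurable M (count_space UNIV)"
    and "\<And>k. 1 \<le> k \<Longrightarrow> X k \<in> borel_measurable M"
  shows "(\<lambda>\<omega>. \<Sum>k=1..T \<omega>. X k \<omega>) \<in> borel_measurable M"
proof -
  have "(\<lambda>\<omega>. \<Sum>k=1..n. X k \<omega>) \<in> borel_measurable M" for n
    using assms(2) by (intro borel_measurable_sum) auto
  then show ?thesis using T by (rule measurable_compose_countable)
qed

text \<open>For a fixed number \<open>n\<close> of summands the characteristic function is an
  \<open>n\<close>-th power, since the \<open>X k\<close> are i.i.d.; independence of
  \<open>N i\<close> from the whole family then permits averaging over \<open>n\<close>.\<close>

lemma char_random_sum:
  fixes X :: "nat \<Rightarrow> 'a \<Rightarrow> real"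
  assumes X: "indep_vars (\<lambda>_. borel) X {1..}"
    and ident: "\<And>n. 1 \<le> n \<Longrightarrow> distr M borel (X n) = distr M borel (X 1)"
    and fam: "indep_families I (count_space UNIV) N {1..} borel X" and "i \<in> I"
  shows "char (distr M borel (\<lambda>\<omega>. c * (\<Sum>k=1..N i \<omega>. X k \<omega>))) u
    = expectation (\<lambda>\<omega>. char (distr M borel (X 1)) (u * c) ^ N i \<omega>)"
proof -
  have X_rv [measurable]: "X k \<in> borel_measurable M" if "1 \<le> k" for k
    using X that by (auto simp: indep_vars_def)
  have N_rv [measurable]: "N i \<in> measurable M (count_space UNIV)"
    using fam \<open>i \<in> I\<close> by (auto simp: indep_families_def)
  have sum_rv [measurable]: "(\<lambda>\<omega>. \<Sum>k=1..n. X k \<omega>) \<in> borel_measurable M" for n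
    by (rule borel_measurable_sum) auto
  note random_sum_measurable[OF N_rv X_rv, measurable]
  define W where "W n \<omega> = iexp (u * (c * (\<Sum>k=1..n. X k \<omega>)))" for n \<omega>
  have W_char: "expectation (W n) = char (distr M borel (X 1)) (u * c) ^ n" for n
  proof -
    have "expectation (W n) = char (distr M borel (\<lambda>\<omega>. \<Sum>k\<in>{1..n}. X k \<omega>)) (u * c)"
      by (simp add: char_def integral_distr W_def[abs_def] mult.assoc)
    also have "\<dots> = (\<Prod>k\<in>{1..n}. char (distr M borel (X k)) (u * c))"
      by (intro char_distr_sum indep_vars_subset[OF X]) auto
    also have "\<dots> = (\<Prod>k\<in>{1..n}. char (distr M borel (X 1)) (u * c))"
    proof (rule prod.cong[OF refl])
      fix k assume "k \<in> {1..n}"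
      then have "distr M borel (X k) = distr M borel (X 1)" by (intro ident) simp
      then show "char (distr M borel (X k)) (u * c) = char (distr M borel (X 1)) (u * c)" by simp
    qed
    finally show ?thesis by simp
  qed
  have "char (distr M borel (\<lambda>\<omega>. c * (\<Sum>k=1..N i \<omega>. X k \<omega>))) u = expectation (\<lambda>\<omega>. W (N i \<omega>) \<omega>)"
    by (simp add: char_def integral_distr W_def)
  also have "\<dots> = expectation (\<lambda>\<omega>. expectation (W (N i \<omega>)))"
  proof (rule expectation_indep_nat_index)
    fix n
    \<comment> \<open>Partial sums are measurable already for this sigma-algebra, which is what
      yields their independence from \<open>N i\<close>.\<close>
    let ?G = "sigma (space M) {X j -` B \<inter> space M | j B. j \<in> {1..} \<and> B \<in> sets borel}"
    have "X k \<in> borel_measurable ?G" if "k \<in> {1..}" for k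
      by (rule measurable_generated_member[OF that]) auto
    then have [measurable]: "(\<lambda>\<omega>. \<Sum>k=1..n. X k \<omega>) \<in> borel_measurable ?G"
      by (intro borel_measurable_sum) auto
    have "W n \<in> borel_measurable ?G" unfolding W_def by measurable
    moreover have "W n \<in> borel_measurable M" unfolding W_def by measurable
    ultimately show "indep_var borel (\<lambda>\<omega>. of_bool (N i \<omega> = n)) borel (W n)"
      by (rule indep_families_indep_var[OF fam \<open>i \<in> I\<close>]) simp
  qed (simp_all add: W_def)
  also have "\<dots> = expectation (\<lambda>\<omega>. char (distr M borel (X 1)) (u * c) ^ N i \<omega>)"
    unfolding W_char ..
  finally show ?thesis .
qed

end

text \<open>The summands are averaged first, then the Poisson counts at the random time, and finally
  the law of that time is replaced by the scaled law of \<open>L 1\<close>. The factor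
  \<open>t powr \<nu>\<close> is grouped with the characteristic function minus 1 because this
  product converges, while \<open>L 1\<close> does not depend on \<open>t\<close>.\<close>

lemma char_fractional_random_sum:
  fixes X :: "nat \<Rightarrow> 'a \<Rightarrow> real"
  assumes "prob_space M" "prob_space M'" "0 < \<nu>" "0 < r" "0 < t"
    and X: "prob_space.indep_vars M (\<lambda>_. borel) X {1..}"
    and ident: "\<And>n. 1 \<le> n \<Longrightarrow> distr M borel (X n) = distr M borel (X 1)"
    and N: "prob_space.time_fractional_poisson_process M \<nu> r N"
    and fam: "prob_space.indep_families M {0..} (count_space UNIV) N {1..} borel X"
    and L: "prob_space.inverse_stable_subordinator M' \<nu> L"
  shows "char (distr M borel (\<lambda>\<omega>. c * (\<Sum>k=1..N t \<omega>. X k \<omega>))) u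
    = (\<integral>\<omega>. exp (L 1 \<omega> * (r * (complex_of_real (t powr \<nu>) * (char (distr M borel (X 1)) (u * c) - 1)))) \<partial>M')"
proof -
  interpret M: prob_space M by fact
  interpret M': prob_space M' by fact
  define z where "z = char (distr M borel (X 1)) (u * c)"
  have "X 1 \<in> borel_measurable M" using X by (auto simp: M.indep_vars_def)
  then interpret X1: real_distribution "distr M borel (X 1)" by simp
  have z: "norm z \<le> 1" unfolding z_def by (rule X1.cmod_char_le_1)
  obtain N1 \<Lambda> where N1: "M.poisson_process r N1" and \<Lambda>: "M.inverse_stable_subordinator \<nu> \<Lambda>"
    and fam': "M.indep_families {0..} (count_space UNIV) N1 {0..} borel \<Lambda>"
    and N_eq: "AE \<omega> in M. \<forall>t\<ge>0. N t \<omega> = N1 (\<Lambda> t \<omega>) \<omega>"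
    using N unfolding M.time_fractional_poisson_process_def by blast
  have t: "t \<in> {0..}" using \<open>0 < t\<close> by simp
  have [measurable]: "\<Lambda> t \<in> borel_measurable M" "L 1 \<in> borel_measurable M'"
    using t M.inverse_stable_subordinator_measurable[OF \<Lambda>] M'.inverse_stable_subordinator_measurable[OF L]
    by auto
  have "char (distr M borel (\<lambda>\<omega>. c * (\<Sum>k=1..N t \<omega>. X k \<omega>))) u = M.expectation (\<lambda>\<omega>. z ^ N t \<omega>)"
    unfolding z_def using X ident fam t by (rule M.char_random_sum)
  also have "\<dots> = M.expectation (\<lambda>\<omega>. exp (complex_of_real (r * \<Lambda> t \<omega>) * (z - 1)))"
  proof (rule M.poisson_process_random_time_pgf[OF N1 \<open>0 < r\<close> z fam' t])
    show "AE \<omega> in M. 0 \<le> \<Lambda> t \<omega>"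
      using \<Lambda> t by (intro M.inverse_stable_subordinator_nonneg) auto
    show "N t \<in> measurable M (count_space UNIV)"
      using N t by (simp add: M.time_fractional_poisson_process_def)
    show "AE \<omega> in M. N t \<omega> = N1 (\<Lambda> t \<omega>) \<omega>" using N_eq t by auto
  qed
  also have "\<dots> = (\<integral>x. exp (complex_of_real (r * x) * (z - 1)) \<partial>distr M borel (\<Lambda> t))"
    by (subst integral_distr) auto
  also have "distr M borel (\<Lambda> t) = distr M' borel (\<lambda>\<omega>. t powr \<nu> * L 1 \<omega>)"
    using assms \<Lambda> L by (intro inverse_stable_subordinator_scaling) auto
  also have "(\<integral>x. exp (complex_of_real (r * x) * (z - 1)) \<partial>distr M' borel (\<lambda>\<omega>. t powr \<nu> * L 1 \<omega>))
      = (\<integral>\<omega>. exp (complex_of_real (r * (t powr \<nu> * L 1 \<omega>)) * (z - 1)) \<partial>M')"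
    by (subst integral_distr) auto
  finally show ?thesis
    unfolding z_def by (simp add: mult_ac)
qed

section \<open>Expansions of characteristic functions and convergence in distribution\<close>

lemma power_over_fact_le_exp:
  fixes x :: real
  assumes "0 \<le> x"
  shows "x ^ k / fact k \<le> exp x"
proof -
  have "(\<Sum>n\<in>{k}. x ^ n /\<^sub>R fact n) \<le> (\<Sum>n. x ^ n /\<^sub>R fact n)"
    using assms by (intro sum_le_suminf sums_summable[OF exp_converges]) auto
  then show ?thesis
    by (simp add: exp_def divide_inverse mult.commute)
qed

context prob_space
begin

text \<open>One term of the exponential series bounds \<open>\<bar>X\<bar> ^ k\<close> by
  \<open>fact k / \<theta> ^ k * (exp (\<theta> * X) + exp (- \<theta> * X))\<close>, which is
  integrable for \<open>\<theta> = \<delta> / 2\<close>.\<close>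

lemma integrable_power_exp_moments:
  fixes X :: "'a \<Rightarrow> real"
  assumes [measurable]: "X \<in> borel_measurable M" and "0 < \<delta>"
    and int: "\<And>\<theta>. \<bar>\<theta>\<bar> < \<delta> \<Longrightarrow> integrable M (\<lambda>\<omega>. exp (\<theta> * X \<omega>))"
  shows "integrable M (\<lambda>\<omega>. X \<omega> ^ k)"
proof -
  define \<theta> where "\<theta> = \<delta> / 2"
  have \<theta>: "0 < \<theta>" "\<bar>\<theta>\<bar> < \<delta>" "\<bar>- \<theta>\<bar> < \<delta>" using \<open>0 < \<delta>\<close> by (auto simp: \<theta>_def)
  let ?w = "\<lambda>\<omega>. fact k / \<theta> ^ k * (exp (\<theta> * X \<omega>) + exp (- \<theta> * X \<omega>))"
  have w: "integrable M ?w"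
    using int[OF \<theta>(2)] int[OF \<theta>(3)] by (intro integrable_mult_right Bochner_Integration.integrable_add)
  have "AE \<omega> in M. norm (X \<omega> ^ k) \<le> norm (?w \<omega>)"
  proof (rule AE_I2)
    fix \<omega>
    have "(\<theta> * \<bar>X \<omega>\<bar>) ^ k / fact k \<le> exp (\<theta> * \<bar>X \<omega>\<bar>)"
      using \<theta> by (intro power_over_fact_le_exp) simp
    also have "\<dots> \<le> exp (\<theta> * X \<omega>) + exp (- \<theta> * X \<omega>)"
      by (cases "0 \<le> X \<omega>") auto
    finally have "\<theta> ^ k / fact k * \<bar>X \<omega>\<bar> ^ k \<le> exp (\<theta> * X \<omega>) + exp (- \<theta> * X \<omega>)"
      by (simp add: power_mult_distrib)
    from mult_left_mono[OF this, of "fact k / \<theta> ^ k"] \<theta>(1)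
    have "\<bar>X \<omega>\<bar> ^ k \<le> ?w \<omega>" by simp
    then show "norm (X \<omega> ^ k) \<le> norm (?w \<omega>)"
      using \<theta>(1) by (simp add: power_abs)
  qed
  then show ?thesis
    by (rule Bochner_Integration.integrable_bound[OF w, rotated]) measurable
qed

lemma char_first_order:
  fixes X :: "'a \<Rightarrow> real"
  assumes [measurable]: "X \<in> borel_measurable M"
    and int: "\<And>k. integrable M (\<lambda>\<omega>. X \<omega> ^ k)"
  obtains C where "\<And>h. norm (char (distr M borel X) h - (1 + \<i> * h * expectation X)) \<le> C * h\<^sup>2"
proof
  fix h :: real
  let ?m = "expectation (\<lambda>\<omega>. X \<omega> ^ 2)"
  have "norm (char (distr M borel X) h -
      (\<Sum>k\<le>2. ((\<i> * h) ^ k / fact k) * expectation (\<lambda>\<omega>. X \<omega> ^ k))) \<le> (2 * \<bar>h\<bar> ^ 2 / fact 2) * expectation (\<lambda>\<omega>. \<bar>X \<omega>\<bar> ^ 2)"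
    by (rule char_approx1') (auto simp: int)
  then have "norm ((char (distr M borel X) h - (1 + \<i> * h * expectation X)) + h\<^sup>2 / 2 * ?m) \<le> h\<^sup>2 * ?m"
    by (simp add: numeral_2_eq_2 power2_eq_square prob_space algebra_simps)
  moreover have "norm (complex_of_real (h\<^sup>2 / 2 * ?m)) = h\<^sup>2 / 2 * ?m"
    unfolding norm_of_real by simp
  \<comment> \<open>The Taylor remainder of order two contributes \<open>h\<^sup>2 * ?m\<close>;
    moving the quadratic term into the error adds half of that.\<close>
  ultimately show "norm (char (distr M borel X) h - (1 + \<i> * h * expectation X)) \<le> 3 / 2 * ?m * h\<^sup>2"
    using norm_triangle_ineq4[of "(char (distr M borel X) h - (1 + \<i> * h * expectation X)) + h\<^sup>2 / 2 * ?m"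
      "complex_of_real (h\<^sup>2 / 2 * ?m)"] by (simp add: algebra_simps)
qed

lemma char_second_order_centered:
  fixes X :: "'a \<Rightarrow> real"
  assumes [measurable]: "X \<in> borel_measurable M"
    and int: "\<And>k. integrable M (\<lambda>\<omega>. X \<omega> ^ k)" and "expectation X = 0"
  obtains C where "\<And>h. norm (char (distr M borel X) h - (1 - h\<^sup>2 / 2 * variance X)) \<le> C * \<bar>h\<bar> ^ 3"
proof
  fix h :: real
  let ?m = "expectation (\<lambda>\<omega>. X \<omega> ^ 3)" and ?a = "expectation (\<lambda>\<omega>. \<bar>X \<omega>\<bar> ^ 3)"
  have "norm (char (distr M borel X) h -
      (\<Sum>k\<le>3. ((\<i> * h) ^ k / fact k) * expectation (\<lambda>\<omega>. X \<omega> ^ k))) \<le> (2 * \<bar>h\<bar> ^ 3 / fact 3) * ?a"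
    by (rule char_approx1') (auto simp: int)
  moreover have "(\<Sum>k\<le>3. ((\<i> * h) ^ k / fact k) * expectation (\<lambda>\<omega>. X \<omega> ^ k))
      = (1 - h\<^sup>2 / 2 * variance X) + (\<i> * h) ^ 3 / 6 * ?m"
  proof -
    have "{..3} = {0, 1, 2, 3::nat}" by auto
    then show ?thesis using assms(3) by (simp add: prob_space fact_numeral power_mult_distrib)
  qed
  ultimately have "norm ((char (distr M borel X) h - (1 - h\<^sup>2 / 2 * variance X)) - (\<i> * h) ^ 3 / 6 * ?m) \<le> (2 * \<bar>h\<bar> ^ 3 / fact 3) * ?a"
    by (simp only: diff_diff_add)
  moreover have "norm ((\<i> * complex_of_real h) ^ 3 / 6 * ?m) = \<bar>h\<bar> ^ 3 / 6 * \<bar>?m\<bar>"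
    by (simp add: norm_mult norm_power norm_divide)
  \<comment> \<open>The remainder of order three gives \<open>?a / 3\<close>, from
    \<open>2 / fact 3\<close>, and the cubic Taylor term moved into the error gives
    \<open>\<bar>?m\<bar> / 6\<close>.\<close>
  ultimately show "norm (char (distr M borel X) h - (1 - h\<^sup>2 / 2 * variance X)) \<le> (?a / 3 + \<bar>?m\<bar> / 6) * \<bar>h\<bar> ^ 3"
    using norm_triangle_sub[of "char (distr M borel X) h - (1 - h\<^sup>2 / 2 * variance X)" "(\<i> * complex_of_real h) ^ 3 / 6 * ?m"]
    by (simp add: fact_numeral algebra_simps)
qed

text \<open>At \<open>h = u * t powr - \<nu>\<close> the linear term of the expansion, multiplied by
  \<open>t powr \<nu>\<close>, is exactly the limit; the quadratic error becomes a multiple of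
  \<open>t powr - \<nu>\<close>.\<close>

lemma char_generator_limit:
  fixes X :: "'a \<Rightarrow> real"
  assumes [measurable]: "X \<in> borel_measurable M"
    and int: "\<And>k. integrable M (\<lambda>\<omega>. X \<omega> ^ k)" and "0 < \<nu>"
  shows "((\<lambda>t. complex_of_real (t powr \<nu>) * (char (distr M borel X) (u * t powr - \<nu>) - 1))
    \<longlongrightarrow> \<i> * u * expectation X) at_top"
proof -
  obtain C where C: "\<And>h. norm (char (distr M borel X) h - (1 + \<i> * h * expectation X)) \<le> C * h\<^sup>2"
    using char_first_order[OF assms(1,2)] by blast
  have "((\<lambda>t. complex_of_real (t powr \<nu>) * (char (distr M borel X) (u * t powr - \<nu>) - 1)
      - \<i> * u * expectation X) \<longlongrightarrow> 0) at_top"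
  proof (rule Lim_null_comparison)
    show "((\<lambda>t. C * u\<^sup>2 * t powr - \<nu>) \<longlongrightarrow> 0) at_top"
      using \<open>0 < \<nu>\<close> by (intro tendsto_mult_right_zero tendsto_neg_powr filterlim_ident) auto
    show "\<forall>\<^sub>F t in at_top. norm (complex_of_real (t powr \<nu>) * (char (distr M borel X) (u * t powr - \<nu>) - 1)
        - \<i> * u * expectation X) \<le> C * u\<^sup>2 * t powr - \<nu>"
      using eventually_gt_at_top[of 0]
    proof eventually_elim
      case (elim t)
      define s where "s = t powr \<nu>"
      have s: "0 < s" "t powr - \<nu> = 1 / s" using elim by (auto simp: s_def powr_minus_divide)
      have "complex_of_real s * (char (distr M borel X) (u / s) - 1) - \<i> * u * expectation X
          = complex_of_real s * (char (distr M borel X) (u / s) - (1 + \<i> * (u / s) * expectation X))"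
        using s by (simp add: field_simps)
      also have "norm \<dots> \<le> s * (C * (u / s)\<^sup>2)"
        using C[of "u / s"] s by (simp add: norm_mult)
      also have "\<dots> = C * u\<^sup>2 * (1 / s)"
        using s by (simp add: power2_eq_square field_simps)
      finally show ?case unfolding s(2) s_def[symmetric] by simp
    qed
  qed
  then show ?thesis by (rule Lim_transform[OF tendsto_const])
qed

text \<open>Without a linear term the quadratic one dominates, and
  \<open>h = u * t powr - (\<nu> / 2)\<close> balances it against \<open>t powr \<nu>\<close>. The
  cubic error leaves a multiple of \<open>t powr - (\<nu> / 2)\<close>.\<close>

lemma char_generator_limit_centered:
  fixes X :: "'a \<Rightarrow> real"
  assumes [measurable]: "X \<in> borel_measurable M"
    and int: "\<And>k. integrable M (\<lambda>\<omega>. X \<omega> ^ k)" and "expectation X = 0" and "0 < \<nu>"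
  shows "((\<lambda>t. complex_of_real (t powr \<nu>) * (char (distr M borel X) (u * t powr - (\<nu> / 2)) - 1))
    \<longlongrightarrow> complex_of_real (- u\<^sup>2 / 2 * variance X)) at_top"
proof -
  obtain C where C: "\<And>h. norm (char (distr M borel X) h - (1 - h\<^sup>2 / 2 * variance X)) \<le> C * \<bar>h\<bar> ^ 3"
    using char_second_order_centered[OF assms(1,2,3)] by blast
  have "((\<lambda>t. complex_of_real (t powr \<nu>) * (char (distr M borel X) (u * t powr - (\<nu> / 2)) - 1)
      - complex_of_real (- u\<^sup>2 / 2 * variance X)) \<longlongrightarrow> 0) at_top"
  proof (rule Lim_null_comparison)
    show "((\<lambda>t. C * \<bar>u\<bar> ^ 3 * t powr - (\<nu> / 2)) \<longlongrightarrow> 0) at_top"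
      using \<open>0 < \<nu>\<close> by (intro tendsto_mult_right_zero tendsto_neg_powr filterlim_ident) auto
    show "\<forall>\<^sub>F t in at_top. norm (complex_of_real (t powr \<nu>) * (char (distr M borel X) (u * t powr - (\<nu> / 2)) - 1)
        - complex_of_real (- u\<^sup>2 / 2 * variance X)) \<le> C * \<bar>u\<bar> ^ 3 * t powr - (\<nu> / 2)"
      using eventually_gt_at_top[of 0]
    proof eventually_elim
      case (elim t)
      define s where "s = t powr (\<nu> / 2)"
      have s: "0 < s" "t powr - (\<nu> / 2) = 1 / s" using elim by (auto simp: s_def powr_minus_divide)
      have s2: "t powr \<nu> = s\<^sup>2" by (simp add: s_def power2_eq_square powr_add[symmetric])
      have "complex_of_real (s\<^sup>2) * (char (distr M borel X) (u / s) - 1) - complex_of_real (- u\<^sup>2 / 2 * variance X)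
          = complex_of_real (s\<^sup>2) * (char (distr M borel X) (u / s) - (1 - (u / s)\<^sup>2 / 2 * variance X))"
        using s by (simp add: field_simps)
      also have "norm \<dots> \<le> s\<^sup>2 * (C * \<bar>u / s\<bar> ^ 3)"
        unfolding norm_mult using C[of "u / s"] s by (intro mult_mono) (auto simp: norm_power)
      also have "\<dots> = C * \<bar>u\<bar> ^ 3 * (1 / s)"
        using s by (simp add: power2_eq_square power3_eq_cube field_simps)
      finally show ?case unfolding s(2) s2 by simp
    qed
  qed
  then show ?thesis by (rule Lim_transform[OF tendsto_const])
qed

text \<open>By Fubini, integrating over \<open>Z\<close> first for a fixed value \<open>v\<close> of
  \<open>V\<close> gives the standard normal characteristic function at
  \<open>u * v\<close>.\<close>

lemma char_normal_mixture:
  fixes V Z :: "'a \<Rightarrow> real"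
  assumes indep: "indep_var borel V borel Z" and Z: "distributed M lborel Z std_normal_density"
  shows "char (distr M borel (\<lambda>\<omega>. V \<omega> * Z \<omega>)) u = expectation (\<lambda>\<omega>. exp (- ((u * V \<omega>)\<^sup>2) / 2))"
proof -
  have [measurable]: "V \<in> borel_measurable M" "Z \<in> borel_measurable M"
    using indep by (auto dest: indep_var_rv1 indep_var_rv2)
  have Z_distr: "distr M borel Z = std_normal_distribution"
    using distributed_distr_eq_density[OF Z] by (simp cong: distr_cong)
  interpret V: prob_space "distr M borel V" by (rule prob_space_distr) simp
  interpret Z: prob_space "distr M borel Z" by (rule prob_space_distr) simp
  interpret VZ: pair_prob_space "distr M borel V" "distr M borel Z" ..
  have "char (distr M borel (\<lambda>\<omega>. V \<omega> * Z \<omega>)) u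
      = (\<integral>p. iexp (u * (fst p * snd p)) \<partial>distr M (borel \<Otimes>\<^sub>M borel) (\<lambda>\<omega>. (V \<omega>, Z \<omega>)))"
    by (simp add: char_def integral_distr)
  also have "\<dots> = (\<integral>p. iexp (u * (fst p * snd p)) \<partial>(distr M borel V \<Otimes>\<^sub>M distr M borel Z))"
    using indep unfolding indep_var_distribution_eq by simp
  also have "\<dots> = (\<integral>v. (\<integral>z. iexp (u * (fst (v, z) * snd (v, z))) \<partial>distr M borel Z) \<partial>distr M borel V)"
    by (intro VZ.integral_fst'[symmetric] VZ.integrable_const_bound[of _ 1]) auto
  also have "\<dots> = (\<integral>v. char (distr M borel Z) (u * v) \<partial>distr M borel V)"
    by (simp add: char_def mult.assoc)
  also have "\<dots> = expectation (\<lambda>\<omega>. complex_of_real (exp (- ((u * V \<omega>)\<^sup>2) / 2)))"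
    unfolding Z_distr char_std_normal_distribution by (subst integral_distr) auto
  finally show ?thesis unfolding integral_complex_of_real .
qed

end

section \<open>Convergence in distribution along real time\<close>

lemma converges_in_distribution_cong:
  assumes "\<forall>\<^sub>F i in F. \<forall>\<omega>. Y i \<omega> = W i \<omega>" "converges_in_distribution M W M' V F"
  shows "converges_in_distribution M Y M' V F"
  unfolding converges_in_distribution_def
proof (intro allI impI)
  fix x assume "isCont (cdf (distr M' borel V)) x"
  then have "((\<lambda>i. cdf (distr M borel (W i)) x) \<longlongrightarrow> cdf (distr M' borel V) x) F"
    using assms(2) by (simp add: converges_in_distribution_def)
  moreover have "\<forall>\<^sub>F i in F. cdf (distr M borel (W i)) x = cdf (distr M borel (Y i)) x"
    using assms(1) by eventually_elim (metis ext)
  ultimately show "((\<lambda>i. cdf (distr M borel (Y i)) x) \<longlongrightarrow> cdf (distr M' borel V) x) F"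
    by (rule Lim_transform_eventually)
qed

lemma converges_in_distribution_at_topI:
  fixes Y :: "real \<Rightarrow> 'a \<Rightarrow> real"
  assumes "prob_space M" "prob_space M'"
    and Y: "\<And>t. 0 < t \<Longrightarrow> Y t \<in> borel_measurable M" and V: "V \<in> borel_measurable M'"
    and chars: "\<And>u. ((\<lambda>t. char (distr M borel (Y t)) u) \<longlongrightarrow> char (distr M' borel V) u) at_top"
  shows "converges_in_distribution M Y M' V at_top"
  unfolding converges_in_distribution_def
proof (intro allI impI tendsto_at_topI_sequentially)
  interpret M: prob_space M by fact
  interpret M': prob_space M' by fact
  fix x and T :: "nat \<Rightarrow> real"
  assume cont: "isCont (cdf (distr M' borel V)) x" and T: "filterlim T at_top sequentially"
  \<comment> \<open>Measurability of \<open>Y t\<close> is assumed only for positive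
    \<open>t\<close>, so the finitely many nonpositive terms of the sequence are replaced by 1
    before Levy's theorem is applied.\<close>
  define T' where "T' n = (if 0 < T n then T n else 1)" for n
  have ev: "\<forall>\<^sub>F n in sequentially. T' n = T n"
    using T[THEN filterlim_at_top_dense[THEN iffD1], rule_format, of 0] by eventually_elim (simp add: T'_def)
  then have T': "filterlim T' at_top sequentially"
    using T by (simp cong: filterlim_cong)
  have "weak_conv_m (\<lambda>n. distr M borel (Y (T' n))) (distr M' borel V)"
  proof (rule levy_continuity)
    show "real_distribution (distr M borel (Y (T' n)))" for n
      using Y[of "T' n"] by (intro M.real_distribution_distr) (simp add: T'_def)
    show "real_distribution (distr M' borel V)" using V by simp
    show "(\<lambda>n. char (distr M borel (Y (T' n))) u) \<longlonglongrightarrow> char (distr M' borel V) u" for u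
      using chars[of u] T' by (rule filterlim_compose)
  qed
  then have "(\<lambda>n. cdf (distr M borel (Y (T' n))) x) \<longlonglongrightarrow> cdf (distr M' borel V) x"
    using cont by (simp add: weak_conv_m_def weak_conv_def)
  then show "(\<lambda>n. cdf (distr M borel (Y (T n))) x) \<longlonglongrightarrow> cdf (distr M' borel V) x"
    by (rule Lim_transform_eventually) (use ev in eventually_elim, simp)
qed

section \<open>The weak limit\<close>

text \<open>The normalisation \<open>c\<close> and the limit \<open>\<Psi>\<close> stay abstract so
  that the centred and the non-centred case are both instances. Dominated convergence rests on
  \<open>L 1\<close> being nonnegative almost surely.\<close>

lemma fractional_random_sum_converges:
  fixes X :: "nat \<Rightarrow> 'a \<Rightarrow> real" and V :: "'b \<Rightarrow> real"
  assumes "prob_space M" "prob_space M'" "0 < \<nu>" "0 < r"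
    and X: "prob_space.indep_vars M (\<lambda>_. borel) X {1..}"
    and ident: "\<And>n. 1 \<le> n \<Longrightarrow> distr M borel (X n) = distr M borel (X 1)"
    and N: "prob_space.time_fractional_poisson_process M \<nu> r N"
    and fam: "prob_space.indep_families M {0..} (count_space UNIV) N {1..} borel X"
    and L: "prob_space.inverse_stable_subordinator M' \<nu> L"
    and V: "V \<in> borel_measurable M'"
    and generator: "\<And>u. ((\<lambda>t. complex_of_real (t powr \<nu>) * (char (distr M borel (X 1)) (u * c t) - 1))
      \<longlongrightarrow> \<Psi> u) at_top"
    and char_V: "\<And>u. char (distr M' borel V) u = (\<integral>\<omega>. exp (L 1 \<omega> * (r * \<Psi> u)) \<partial>M')"
  shows "converges_in_distribution M (\<lambda>t \<omega>. c t * (\<Sum>k=1..N t \<omega>. X k \<omega>)) M' V at_top"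
proof (rule converges_in_distribution_at_topI)
  interpret M: prob_space M by fact
  interpret M': prob_space M' by fact
  have X_rv: "X k \<in> borel_measurable M" if "1 \<le> k" for k
    using X that by (auto simp: M.indep_vars_def)
  show "(\<lambda>\<omega>. c t * (\<Sum>k=1..N t \<omega>. X k \<omega>)) \<in> borel_measurable M" if "0 < t" for t
  proof -
    have "N t \<in> measurable M (count_space UNIV)"
      using N that by (simp add: M.time_fractional_poisson_process_def)
    from M.random_sum_measurable[OF this X_rv] show ?thesis by measurable
  qed
  have [measurable]: "L 1 \<in> borel_measurable M'"
    by (rule M'.inverse_stable_subordinator_measurable[OF L]) simp
  have nonneg: "AE \<omega> in M'. 0 \<le> L 1 \<omega>"
    by (rule M'.inverse_stable_subordinator_nonneg[OF L]) simp
  interpret X1: real_distribution "distr M borel (X 1)"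
    using X_rv by simp
  fix u
  let ?\<phi> = "\<lambda>t. char (distr M borel (X 1)) (u * c t)"
  have "((\<lambda>t. \<integral>\<omega>. exp (L 1 \<omega> * (r * (complex_of_real (t powr \<nu>) * (?\<phi> t - 1)))) \<partial>M')
      \<longlongrightarrow> (\<integral>\<omega>. exp (L 1 \<omega> * (r * \<Psi> u)) \<partial>M')) at_top"
  proof (rule integral_dominated_convergence_at_top[where w="\<lambda>_. 1"])
    show "\<forall>\<^sub>F t in at_top. AE \<omega> in M'. norm (exp (L 1 \<omega> * (r * (complex_of_real (t powr \<nu>) * (?\<phi> t - 1))))) \<le> 1"
    proof (rule always_eventually, rule allI)
      fix t
      show "AE \<omega> in M'. norm (exp (L 1 \<omega> * (r * (complex_of_real (t powr \<nu>) * (?\<phi> t - 1))))) \<le> 1"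
        using nonneg
      proof eventually_elim
        case (elim \<omega>)
        have "exp (L 1 \<omega> * (r * (complex_of_real (t powr \<nu>) * (?\<phi> t - 1))))
            = exp (complex_of_real (L 1 \<omega> * (r * t powr \<nu>)) * (?\<phi> t - 1))"
          by (simp only: of_real_mult mult.assoc)
        moreover have "0 \<le> L 1 \<omega> * (r * t powr \<nu>)"
          using elim \<open>0 < r\<close> by simp
        ultimately show ?case
          using norm_exp_generator_le_1[OF X1.cmod_char_le_1] by metis
      qed
    qed
    show "AE \<omega> in M'. ((\<lambda>t. exp (L 1 \<omega> * (r * (complex_of_real (t powr \<nu>) * (?\<phi> t - 1)))))
        \<longlongrightarrow> exp (L 1 \<omega> * (r * \<Psi> u))) at_top"
      by (intro AE_I2 tendsto_exp tendsto_mult tendsto_const generator)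
  qed auto
  moreover have "\<forall>\<^sub>F t in at_top. (\<integral>\<omega>. exp (L 1 \<omega> * (r * (complex_of_real (t powr \<nu>) * (?\<phi> t - 1)))) \<partial>M')
      = char (distr M borel (\<lambda>\<omega>. c t * (\<Sum>k=1..N t \<omega>. X k \<omega>))) u"
    using eventually_gt_at_top[of 0]
    by eventually_elim (rule char_fractional_random_sum[OF assms(1-4) _ X ident N fam L, symmetric])
  ultimately show "((\<lambda>t. char (distr M borel (\<lambda>\<omega>. c t * (\<Sum>k=1..N t \<omega>. X k \<omega>))) u)
      \<longlongrightarrow> char (distr M' borel V) u) at_top"
    unfolding char_V by (rule Lim_transform_eventually)
qed fact+

theorem proposition3p2:
  fixes M :: "'a measure" and M' :: "'b measure"
    and \<nu> lam \<mu> \<sigma>2 :: real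
    and X :: "nat \<Rightarrow> 'a \<Rightarrow> real"
    and N :: "real \<Rightarrow> 'a \<Rightarrow> nat"
    and S :: "real \<Rightarrow> 'a \<Rightarrow> real"
    and L :: "real \<Rightarrow> 'b \<Rightarrow> real"
  assumes "prob_space M"
    and "0 < \<nu>" and "\<nu> < 1" and "0 < lam"
    and "prob_space.indep_vars M (\<lambda>_. borel) X {1..}"
    and "\<forall>n\<ge>1. distr M borel (X n) = distr M borel (X 1)"
    and "\<exists>\<delta>>0. \<forall>\<theta>. \<bar>\<theta>\<bar> < \<delta> \<longrightarrow> integrable M (\<lambda>\<omega>. exp (\<theta> * X 1 \<omega>))"
    and "\<mu> = prob_space.expectation M (X 1)"
    and "\<sigma>2 = prob_space.variance M (X 1)"
    and "prob_space.time_fractional_poisson_process M \<nu> lam N"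
    and "prob_space.indep_families M {0..} (count_space UNIV) N {1..} borel X"
    and "\<forall>t\<ge>0. \<forall>\<omega>. S t \<omega> = (\<Sum>k=1..N t \<omega>. X k \<omega>)"
    and "prob_space M'"
    and "prob_space.inverse_stable_subordinator M' \<nu> L"
  shows
    "(\<mu> = 0 \<longrightarrow>
        (\<forall>Z :: 'b \<Rightarrow> real.
           distributed M' lborel Z std_normal_density \<and> prob_space.indep_var M' borel (L 1) borel Z \<longrightarrow>
           converges_in_distribution M (\<lambda>t \<omega>. t powr scaling_exponent \<nu> \<mu> * (S t \<omega> / t))
             M' (\<lambda>\<omega>. sqrt (lam * \<sigma>2 * L 1 \<omega>) * Z \<omega>) at_top)) \<and>
     (\<mu> \<noteq> 0 \<longrightarrow>
        converges_in_distribution M (\<lambda>t \<omega>. t powr scaling_exponent \<nu> \<mu> * (S t \<omega> / t))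
          M' (\<lambda>\<omega>. lam * \<mu> * L 1 \<omega>) at_top)"
proof -
  interpret M: prob_space M by fact
  interpret M': prob_space M' by fact
  have ident: "distr M borel (X n) = distr M borel (X 1)" if "1 \<le> n" for n
    using assms(6) that by blast
  have X1 [measurable]: "X 1 \<in> borel_measurable M"
    using assms(5) by (auto simp: M.indep_vars_def)
  obtain \<delta> where "0 < \<delta>" and "\<And>\<theta>. \<bar>\<theta>\<bar> < \<delta> \<Longrightarrow> integrable M (\<lambda>\<omega>. exp (\<theta> * X 1 \<omega>))"
    using assms(7) by blast
  then have moments: "integrable M (\<lambda>\<omega>. X 1 \<omega> ^ k)" for k
    by (rule M.integrable_power_exp_moments[OF X1])
  have L1 [measurable]: "L 1 \<in> borel_measurable M'"
    by (rule M'.inverse_stable_subordinator_measurable[OF assms(14)]) simp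
  have nonneg: "AE \<omega> in M'. 0 \<le> L 1 \<omega>"
    by (rule M'.inverse_stable_subordinator_nonneg[OF assms(14)]) simp
  have \<sigma>2: "0 \<le> \<sigma>2" unfolding assms(9) by simp
  \<comment> \<open>Dividing by \<open>t\<close> lowers the exponent by 1, leaving
    \<open>- \<nu> / 2\<close> in the centred case and \<open>- \<nu>\<close> otherwise. The
    rewriting is valid for positive \<open>t\<close>.\<close>
  have scaled_sum: "\<forall>\<^sub>F t in at_top. \<forall>\<omega>. t powr \<alpha> * (S t \<omega> / t) = t powr (\<alpha> - 1) * (\<Sum>k=1..N t \<omega>. X k \<omega>)"
    for \<alpha>
    using eventually_gt_at_top[of 0]
  proof eventually_elim
    case (elim t)
    then show ?case using assms(12) by (simp add: powr_diff)
  qed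
  note converges = fractional_random_sum_converges[OF assms(1,13,2,4,5) ident assms(10,11,14)]
  show ?thesis
  proof (intro conjI impI allI)
    fix Z :: "'b \<Rightarrow> real"
    assume "\<mu> = 0" and Z: "distributed M' lborel Z std_normal_density \<and> M'.indep_var borel (L 1) borel Z"
    have [measurable]: "Z \<in> borel_measurable M'"
      using Z by (auto dest: M'.indep_var_rv2)
    show "converges_in_distribution M (\<lambda>t \<omega>. t powr scaling_exponent \<nu> \<mu> * (S t \<omega> / t))
        M' (\<lambda>\<omega>. sqrt (lam * \<sigma>2 * L 1 \<omega>) * Z \<omega>) at_top"
    proof (rule converges_in_distribution_cong[OF scaled_sum], rule converges)
      show "((\<lambda>t. complex_of_real (t powr \<nu>) *
          (char (distr M borel (X 1)) (u * t powr (scaling_exponent \<nu> \<mu> - 1)) - 1))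
          \<longlongrightarrow> complex_of_real (- u\<^sup>2 / 2 * \<sigma>2)) at_top" for u
        using M.char_generator_limit_centered[OF X1 moments, of \<nu> u] assms(2,8,9) \<open>\<mu> = 0\<close>
        by (simp add: scaling_exponent_def)
      have "M'.indep_var borel ((\<lambda>x. sqrt (lam * \<sigma>2 * x)) \<circ> L 1) borel (id \<circ> Z)"
        using Z by (intro M'.indep_var_compose) auto
      then have indep: "M'.indep_var borel (\<lambda>\<omega>. sqrt (lam * \<sigma>2 * L 1 \<omega>)) borel Z"
        by (simp add: comp_def)
      fix u
      have "char (distr M' borel (\<lambda>\<omega>. sqrt (lam * \<sigma>2 * L 1 \<omega>) * Z \<omega>)) u
          = M'.expectation (\<lambda>\<omega>. exp (- ((u * sqrt (lam * \<sigma>2 * L 1 \<omega>))\<^sup>2) / 2))"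
        using indep Z by (intro M'.char_normal_mixture) auto
      also have "\<dots> = M'.expectation (\<lambda>\<omega>. exp (L 1 \<omega> * (lam * (- u\<^sup>2 / 2 * \<sigma>2))))"
      \<comment> \<open>Squaring undoes the square root only where its argument is nonnegative,
        hence the almost sure comparison; it is made between real integrals, before the cast to
        complex moves inside.\<close>
      proof (intro arg_cong[where f=complex_of_real] integral_cong_AE)
        show "AE \<omega> in M'. exp (- ((u * sqrt (lam * \<sigma>2 * L 1 \<omega>))\<^sup>2) / 2)
            = exp (L 1 \<omega> * (lam * (- u\<^sup>2 / 2 * \<sigma>2)))"
          using nonneg by eventually_elim (use \<sigma>2 assms(4) in \<open>simp add: power_mult_distrib mult_ac\<close>)
      qed auto
      also have "\<dots> = M'.expectation (\<lambda>\<omega>. complex_of_real (exp (L 1 \<omega> * (lam * (- u\<^sup>2 / 2 * \<sigma>2)))))"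
        by (rule integral_complex_of_real[symmetric])
      also have "\<dots> = M'.expectation (\<lambda>\<omega>. exp (L 1 \<omega> * (lam * complex_of_real (- u\<^sup>2 / 2 * \<sigma>2))))"
        by (simp only: exp_of_real[symmetric] of_real_mult)
      finally show "char (distr M' borel (\<lambda>\<omega>. sqrt (lam * \<sigma>2 * L 1 \<omega>) * Z \<omega>)) u
          = M'.expectation (\<lambda>\<omega>. exp (L 1 \<omega> * (lam * complex_of_real (- u\<^sup>2 / 2 * \<sigma>2))))" .
    qed measurable
  next
    assume "\<mu> \<noteq> 0"
    show "converges_in_distribution M (\<lambda>t \<omega>. t powr scaling_exponent \<nu> \<mu> * (S t \<omega> / t))
        M' (\<lambda>\<omega>. lam * \<mu> * L 1 \<omega>) at_top"
    proof (rule converges_in_distribution_cong[OF scaled_sum], rule converges)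
      show "((\<lambda>t. complex_of_real (t powr \<nu>) *
          (char (distr M borel (X 1)) (u * t powr (scaling_exponent \<nu> \<mu> - 1)) - 1))
          \<longlongrightarrow> \<i> * u * \<mu>) at_top" for u
        using M.char_generator_limit[OF X1 moments assms(2), of u] \<open>\<mu> \<noteq> 0\<close> assms(8)
        by (simp add: scaling_exponent_def)
      show "char (distr M' borel (\<lambda>\<omega>. lam * \<mu> * L 1 \<omega>)) u
          = M'.expectation (\<lambda>\<omega>. exp (L 1 \<omega> * (lam * (\<i> * u * \<mu>))))" for u
        by (simp add: char_def integral_distr mult_ac)
    qed measurable
  qed
qed

end
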